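(* Let $Q$ be a Noetherian commutative monoid and let $\Bbbk=\overline{\Bbbk}$ be an algebraically closed field. Let $M$ be a finitely generated $\Bbbk[Q]$-module tightly graded by a $Q$-module $T$. Every binomial submodule $N\subset M$ admits a primary decomposition in which each component is again a binomial submodule of $M$.
   Context: $Q$ is a commutative monoid, written additively with identity $0$; Noetherian means equivalently finitely generated. ${\bf x}^q$ is the monomial of $q\in Q$ in the monoid algebra $\Bbbk[Q]$. A $Q$-module is a set $T$ with an action of $Q$ such that $0\cdot t=t$, $(q+q')\cdot t=q\cdot(q'\cdot t)$. An element $\infty\in T$ is nil if $Q\cdot\infty=\{\infty\}$; $N(T)$ is the set of nils. A $Q$-orbit of a subset $U\subset T$ is a connected component of the undirected graph on $U$ with an edge between $s,t$ whenever $q\cdot s=t$ for some $q\in Q$; a $Q$-module $T$ is properly connected if $T\setminus N(T)$ has at most one $Q$-orbit. $M$ is $T$-graded if $M\cong\bigoplus_{t\in T}M_t$ as abelian groups with $M_t$ finite-dimensional vector spaces and ${\bf x}^qM_t\subset M_{q\cdot t}$ for all $q,t$. The grading is fine if $\dim_\Bbbk M_t\le1$ for all $t$. A fine grading is tight if (i) $M_t\ne0$ for each non-nil $t\in T$; (ii) the $Q$-orbit of each $\infty\in N(T)$ with $M_\infty=0$ is properly connected; (iii) whenever $0\ne m\in M_t$ and ${\bf x}^qm=0$, we have $\dim_\Bbbk M_{q\cdot t}=0$. A nonzero element of $M$ is a monomial if it is homogeneous for the $T$-grading, and a binomial if it is a sum of at most two monomials. A submodule of $M$ is binomial if it is generated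 by binomials. *)

theory Defs
  imports "HOL-Library.Poly_Mapping" "HOL-Computational_Algebra.Computational_Algebra"
begin

text \<open>
  The monoid \<open>Q\<close> is a type \<open>'q\<close> of class \<^class>\<open>comm_monoid_add\<close>, and the monoid algebra of \<open>Q\<close>
  over \<open>'k\<close> is \<open>'q \<Rightarrow>\<^sub>0 'k\<close> with its convolution product. A module over it is a type \<open>'m\<close>
  with a scalar multiplication satisfying \<^locale>\<open>module\<close>, so submodules are
  \<open>module.subspace scale\<close>. Sets with an action of \<open>Q\<close> have explicit carriers, so
  that they may be empty and so that orbits are again such sets.
\<close>

definition fg_monoid :: "'q::comm_monoid_add set \<Rightarrow> bool" where
  "fg_monoid A \<longleftrightarrow> (\<exists>G. finite G \<and> A = {sum_list xs | xs. set xs \<subseteq> G})"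

definition monoid_monomial :: "'q \<Rightarrow> ('q \<Rightarrow>\<^sub>0 'k::zero_neq_one)" where
  "monoid_monomial q = Poly_Mapping.single q 1"

definition q_module :: "('q::comm_monoid_add \<Rightarrow> 't \<Rightarrow> 't) \<Rightarrow> 't set \<Rightarrow> bool" where
  "q_module act T \<longleftrightarrow>
     (\<forall>q. \<forall>t\<in>T. act q t \<in> T) \<and>
     (\<forall>t\<in>T. act 0 t = t) \<and>
     (\<forall>q q'. \<forall>t\<in>T. act (q + q') t = act q (act q' t))"

definition nils :: "('q \<Rightarrow> 't \<Rightarrow> 't) \<Rightarrow> 't set \<Rightarrow> 't set" where
  "nils act T = {z \<in> T. range (\<lambda>q. act q z) = {z}}"

text \<open>
  The connected component of \<open>u\<close> in the undirected graph on \<open>U\<close>; meaningful for \<open>u \<in> U\<close>.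
  Paths have to stay inside \<open>U\<close>.
\<close>

definition orbit_of :: "('q \<Rightarrow> 't \<Rightarrow> 't) \<Rightarrow> 't set \<Rightarrow> 't \<Rightarrow> 't set" where
  "orbit_of act U u = {v. equivclp (\<lambda>s t. s \<in> U \<and> t \<in> U \<and> (\<exists>q. act q s = t)) u v}"

definition q_orbits :: "('q \<Rightarrow> 't \<Rightarrow> 't) \<Rightarrow> 't set \<Rightarrow> 't set set" where
  "q_orbits act U = orbit_of act U ` U"

definition properly_connected :: "('q \<Rightarrow> 't \<Rightarrow> 't) \<Rightarrow> 't set \<Rightarrow> bool" where
  "properly_connected act T \<longleftrightarrow>
     (\<forall>A \<in> q_orbits act (T - nils act T). \<forall>B \<in> q_orbits act (T - nils act T). A = B)"

text \<open>The action of the field of constants, i.e. of the multiples of the monomial of \<open>0 \<in> Q\<close>.\<close>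

definition const_scale ::
  "(('q::comm_monoid_add \<Rightarrow>\<^sub>0 'k::field) \<Rightarrow> 'm \<Rightarrow> 'm) \<Rightarrow> 'k \<Rightarrow> 'm \<Rightarrow> 'm" where
  "const_scale scale c m = scale (Poly_Mapping.single 0 c) m"

lemma vector_space_const_scale:
  assumes "module (scale :: ('q::comm_monoid_add \<Rightarrow>\<^sub>0 'k::field) \<Rightarrow> 'm::ab_group_add \<Rightarrow> 'm)"
  shows "vector_space (const_scale scale)"
proof -
  interpret module scale by (rule assms)
  show ?thesis
    by unfold_locales
      (simp_all add: const_scale_def scale_right_distrib single_add scale_left_distrib mult_single)
qed

definition internal_direct_sum :: "'t set \<Rightarrow> ('t \<Rightarrow> 'm::ab_group_add set) \<Rightarrow> bool" where
  "internal_direct_sum T D \<longleftrightarrow>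
     (\<forall>m. \<exists>!f. finite {t. f t \<noteq> 0} \<and> (\<forall>t\<in>T. f t \<in> D t) \<and> (\<forall>t. t \<notin> T \<longrightarrow> f t = 0) \<and>
               m = (\<Sum>t | f t \<noteq> 0. f t))"

text \<open>
  Finite-dimensionality is required explicitly because \<open>vector_space.dim\<close> is \<open>0\<close> on
  infinite-dimensional spaces.
\<close>

definition graded_by ::
  "(('q::comm_monoid_add \<Rightarrow>\<^sub>0 'k::field) \<Rightarrow> 'm::ab_group_add \<Rightarrow> 'm) \<Rightarrow>
   ('q \<Rightarrow> 't \<Rightarrow> 't) \<Rightarrow> 't set \<Rightarrow> ('t \<Rightarrow> 'm set) \<Rightarrow> bool" where
  "graded_by scale act T D \<longleftrightarrow>
     internal_direct_sum T D \<and>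
     (\<forall>t\<in>T. module.subspace (const_scale scale) (D t) \<and>
            (\<exists>B. finite B \<and> module.span (const_scale scale) B = D t)) \<and>
     (\<forall>q. \<forall>t\<in>T. scale (monoid_monomial q) ` D t \<subseteq> D (act q t))"

definition finely_graded_by ::
  "(('q::comm_monoid_add \<Rightarrow>\<^sub>0 'k::field) \<Rightarrow> 'm::ab_group_add \<Rightarrow> 'm) \<Rightarrow>
   ('q \<Rightarrow> 't \<Rightarrow> 't) \<Rightarrow> 't set \<Rightarrow> ('t \<Rightarrow> 'm set) \<Rightarrow> bool" where
  "finely_graded_by scale act T D \<longleftrightarrow>
     graded_by scale act T D \<and>
     (\<forall>t\<in>T. vector_space.dim (const_scale scale) (D t) \<le> 1)"

definition tightly_graded_by ::
  "(('q::comm_monoid_add \<Rightarrow>\<^sub>0 'k::field) \<Rightarrow> 'm::ab_group_add \<Rightarrow> 'm) \<Rightarrow>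
   ('q \<Rightarrow> 't \<Rightarrow> 't) \<Rightarrow> 't set \<Rightarrow> ('t \<Rightarrow> 'm set) \<Rightarrow> bool" where
  "tightly_graded_by scale act T D \<longleftrightarrow>
     finely_graded_by scale act T D \<and>
     (\<forall>t \<in> T - nils act T. D t \<noteq> {0}) \<and>
     (\<forall>z \<in> nils act T. D z = {0} \<longrightarrow> properly_connected act (orbit_of act T z)) \<and>
     (\<forall>q. \<forall>t\<in>T. \<forall>m \<in> D t. m \<noteq> 0 \<and> scale (monoid_monomial q) m = 0 \<longrightarrow>
        vector_space.dim (const_scale scale) (D (act q t)) = 0)"

definition is_monomial :: "'t set \<Rightarrow> ('t \<Rightarrow> 'm::ab_group_add set) \<Rightarrow> 'm \<Rightarrow> bool" where
  "is_monomial T D m \<longleftrightarrow> m \<noteq> 0 \<and> (\<exists>t\<in>T. m \<in> D t)"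

definition is_binomial :: "'t set \<Rightarrow> ('t \<Rightarrow> 'm::ab_group_add set) \<Rightarrow> 'm \<Rightarrow> bool" where
  "is_binomial T D b \<longleftrightarrow> b \<noteq> 0 \<and>
     (is_monomial T D b \<or> (\<exists>m m'. is_monomial T D m \<and> is_monomial T D m' \<and> b = m + m'))"

definition binomial_submodule ::
  "(('q::comm_monoid_add \<Rightarrow>\<^sub>0 'k::field) \<Rightarrow> 'm::ab_group_add \<Rightarrow> 'm) \<Rightarrow>
   't set \<Rightarrow> ('t \<Rightarrow> 'm set) \<Rightarrow> 'm set \<Rightarrow> bool" where
  "binomial_submodule scale T D N \<longleftrightarrow>
     (\<exists>B. (\<forall>b\<in>B. is_binomial T D b) \<and> N = module.span scale B)"

definition fg_module :: "('r::comm_ring_1 \<Rightarrow> 'm::ab_group_add \<Rightarrow> 'm) \<Rightarrow> bool" where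
  "fg_module scale \<longleftrightarrow> module scale \<and> (\<exists>B. finite B \<and> module.span scale B = UNIV)"

text \<open>\<open>P\<close> is proper and every zero-divisor on the quotient by \<open>P\<close> acts nilpotently on it.\<close>

definition primary_submodule ::
  "('r::comm_ring_1 \<Rightarrow> 'm::ab_group_add \<Rightarrow> 'm) \<Rightarrow> 'm set \<Rightarrow> bool" where
  "primary_submodule scale P \<longleftrightarrow>
     module.subspace scale P \<and> P \<noteq> UNIV \<and>
     (\<forall>r m. scale r m \<in> P \<and> m \<notin> P \<longrightarrow> (\<exists>n. \<forall>m'. scale (r ^ n) m' \<in> P))"

text \<open>
  Decompositions are finite and need not be irredundant; the empty one decomposes the whole
  module, as \<open>\<Inter>{} = UNIV\<close>.
\<close>

definition primary_decomposition ::
  "('r::comm_ring_1 \<Rightarrow> 'm::ab_group_add \<Rightarrow> 'm) \<Rightarrow> 'm set \<Rightarrow> 'm set set \<Rightarrow> bool" where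
  "primary_decomposition scale N C \<longleftrightarrow>
     finite C \<and> (\<forall>P\<in>C. primary_submodule scale P) \<and> N = \<Inter>C"

end

theory Submission imports Defs
begin

text \<open>
  By Noetherian induction it suffices to show that a binomial submodule \<open>N\<close> is primary if it is
  not a finite intersection of strictly larger binomial submodules. The nonzero images of the
  \<open>M\<^sub>t\<close> in \<open>M / N\<close> are lines, distinct ones are independent, and monomials of \<open>k[Q]\<close> map a line to a line or to \<open>0\<close>.

  Splitting along \<open>(N : x\<^sup>n) \<inter> (N + x\<^sup>n M)\<close> shows that every monomial \<open>x\<close> is regular or
  nilpotent on \<open>M / N\<close>. If \<open>x\<close> and \<open>y\<close> are regular and \<open>x\<^sup>n - c y\<^sup>n\<close> kills some line, a
  splitting along the \<open>n\<close>-th roots of \<open>c\<close> shows that \<open>x - z y\<close> is nilpotent on \<open>M / N\<close> for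
  some constant \<open>z\<close>; call \<open>x\<close> and \<open>y\<close> commensurable in this case. Hence every \<open>r\<close> in \<open>k[Q]\<close> is the
  sum of a nilpotent element and a combination of pairwise incommensurable regular monomials. The
  regular monomials modulo commensurability form a cancellative torsion-free monoid, which can be
  totally ordered, and comparing leading terms shows that such a combination is regular unless it
  is empty.
\<close>

section \<open>Ascending chains of submodules\<close>

text \<open>Irreducibility is available only against binomial submodules, so every splitting must
  consist of such submodules. \<open>(N : r)\<close> and \<open>N + r M\<close> qualify for a
  monomial \<open>r\<close>, but already the colon of \<open>(x^3 - 1)\<close> by
  \<open>x - 1\<close> in \<open>k[x]\<close> is not binomial. For a difference of monomials the
  colon is therefore replaced by the submodule that \<open>N\<close> and the homogeneous elements
  killed modulo \<open>N\<close> generate, and images are taken under linear forms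
  \<open>x - z y\<close> only, which is why roots of constants must lie in the field. The quotient
  \<open>M / N\<close> is never formed. Its decomposition into lines is used through additive maps
  of \<open>M\<close> that fix some homogeneous elements, kill the others and preserve
  \<open>N\<close>; they need not be linear over the monoid algebra. Commensurable monomials can be
  merged only up to nilpotent elements: for \<open>N = (x^p - 1)\<close> in characteristic
  \<open>p\<close>, \<open>x - 1\<close> is nilpotent but not zero on the quotient.\<close>

locale operator_module = module scale
  for scale :: "'a::comm_ring_1 \<Rightarrow> 'b::ab_group_add \<Rightarrow> 'b"  (infixr \<open>*s\<close> 75)
begin

text \<open>Stability under a set of operators, in place of linearity over a ring, lets the
  generators of \<open>Q\<close> be added one at a time with no ring attached to the intermediate
  stages.\<close>

definition stable_subgroup :: "'a set \<Rightarrow> 'b set \<Rightarrow> bool" where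
  "stable_subgroup S U \<longleftrightarrow>
     0 \<in> U \<and> (\<forall>a\<in>U. \<forall>b\<in>U. a - b \<in> U) \<and> (\<forall>s\<in>S. \<forall>u\<in>U. s *s u \<in> U)"

definition acc_within :: "'a set \<Rightarrow> 'b set \<Rightarrow> bool" where
  "acc_within S L \<longleftrightarrow>
     (\<forall>U. (\<forall>n. stable_subgroup S (U n) \<and> U n \<subseteq> L) \<and> incseq U \<longrightarrow> (\<exists>d. \<forall>n\<ge>d. U n = U d))"

lemma stable_subgroup_0: "stable_subgroup S U \<Longrightarrow> 0 \<in> U"
  and stable_subgroup_diff: "stable_subgroup S U \<Longrightarrow> a \<in> U \<Longrightarrow> b \<in> U \<Longrightarrow> a - b \<in> U"
  and stable_subgroup_scale: "stable_subgroup S U \<Longrightarrow> s \<in> S \<Longrightarrow> a \<in> U \<Longrightarrow> s *s a \<in> U"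
  by (auto simp: stable_subgroup_def)

lemma stable_subgroup_add:
  assumes "stable_subgroup S U" "a \<in> U" "b \<in> U"
  shows "a + b \<in> U"
proof -
  have "a - (0 - b) \<in> U"
    using assms by (blast intro: stable_subgroup_0 stable_subgroup_diff)
  then show ?thesis by simp
qed

lemma stable_subgroup_mono: "stable_subgroup S U \<Longrightarrow> S' \<subseteq> S \<Longrightarrow> stable_subgroup S' U"
  by (auto simp: stable_subgroup_def)

lemma subspace_imp_stable_subgroup: "subspace U \<Longrightarrow> stable_subgroup S U"
  by (auto simp: stable_subgroup_def subspace_0 subspace_diff subspace_scale)

text \<open>This is \<open>L + x L + ... + x^(i-1) L\<close>, the elements of degree below
  \<open>i\<close> in \<open>x\<close>. Expressions need not be unique, since \<open>x\<close> is an
  operator and not an indeterminate.\<close>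

fun powers_below :: "'a \<Rightarrow> 'b set \<Rightarrow> nat \<Rightarrow> 'b set" where
  "powers_below x L 0 = {0}"
| "powers_below x L (Suc i) = {a + x ^ i *s l | a l. a \<in> powers_below x L i \<and> l \<in> L}"

lemma powers_below_SucI:
  "a \<in> powers_below x L i \<Longrightarrow> l \<in> L \<Longrightarrow> a + x ^ i *s l \<in> powers_below x L (Suc i)"
  by auto

definition adjoin_powers :: "'a \<Rightarrow> 'b set \<Rightarrow> 'b set" where
  "adjoin_powers x L = (\<Union>i. powers_below x L i)"

definition leading :: "'a \<Rightarrow> 'b set \<Rightarrow> nat \<Rightarrow> 'b set \<Rightarrow> 'b set" where
  "leading x L i U = {l \<in> L. \<exists>a \<in> powers_below x L i. a + x ^ i *s l \<in> U}"

lemma stable_powers_below: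
  assumes "stable_subgroup S L"
  shows "stable_subgroup S (powers_below x L i)"
proof (induction i)
  case 0
  show ?case by (simp add: stable_subgroup_def)
next
  case (Suc i)
  note L = stable_subgroup_0[OF assms] stable_subgroup_diff[OF assms]
    stable_subgroup_scale[OF assms]
  note P = stable_subgroup_0[OF Suc] stable_subgroup_diff[OF Suc]
    stable_subgroup_scale[OF Suc]
  show ?case
    unfolding stable_subgroup_def
  proof (intro conjI ballI)
    show "0 \<in> powers_below x L (Suc i)"
      using powers_below_SucI[OF P(1) L(1)] by simp
  next
    fix a b assume "a \<in> powers_below x L (Suc i)" "b \<in> powers_below x L (Suc i)"
    then obtain a' l b' l' where "a' \<in> powers_below x L i" "l \<in> L" "a = a' + x ^ i *s l"
      "b' \<in> powers_below x L i" "l' \<in> L" "b = b' + x ^ i *s l'"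
      by auto
    moreover from this have "a - b = (a' - b') + x ^ i *s (l - l')"
      by (simp add: scale_right_diff_distrib)
    ultimately show "a - b \<in> powers_below x L (Suc i)"
      using L(2) P(2) powers_below_SucI by metis
  next
    fix s a assume "s \<in> S" "a \<in> powers_below x L (Suc i)"
    then obtain a' l where "a' \<in> powers_below x L i" "l \<in> L" "a = a' + x ^ i *s l"
      by auto
    moreover from this have "s *s a = s *s a' + x ^ i *s (s *s l)"
      by (simp add: scale_right_distrib mult.commute)
    ultimately show "s *s a \<in> powers_below x L (Suc i)"
      using L(3)[OF \<open>s \<in> S\<close>] P(3)[OF \<open>s \<in> S\<close>] powers_below_SucI by metis
  qed
qed

lemma powers_below_mono_Suc:
  assumes "0 \<in> L"
  shows "powers_below x L i \<subseteq> powers_below x L (Suc i)"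
proof
  fix a assume "a \<in> powers_below x L i"
  from powers_below_SucI[OF this assms] show "a \<in> powers_below x L (Suc i)" by simp
qed

lemma powers_below_mono: "0 \<in> L \<Longrightarrow> i \<le> j \<Longrightarrow> powers_below x L i \<subseteq> powers_below x L j"
  using powers_below_mono_Suc by (rule lift_Suc_mono_le)

lemma powers_below_scale:
  assumes "0 \<in> L"
  shows "a \<in> powers_below x L i \<Longrightarrow> x *s a \<in> powers_below x L (Suc i)"
proof (induction i arbitrary: a)
  case 0
  then show ?case using powers_below_SucI[of 0 x L 0 0] assms by simp
next
  case (Suc i)
  then obtain a' l where "a' \<in> powers_below x L i" "l \<in> L" "a = a' + x ^ i *s l"
    by auto
  moreover from this have "x *s a = x *s a' + x ^ Suc i *s l"
    by (simp add: scale_right_distrib)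
  ultimately show ?case using Suc.IH powers_below_SucI by metis
qed

lemma subset_adjoin_powers:
  shows "L \<subseteq> adjoin_powers x L"
proof
  fix l assume "l \<in> L"
  then have "l \<in> powers_below x L (Suc 0)" using powers_below_SucI[of 0 x L 0 l] by simp
  then show "l \<in> adjoin_powers x L" unfolding adjoin_powers_def by blast
qed

lemma stable_adjoin_powers:
  assumes "stable_subgroup S L"
  shows "stable_subgroup (insert x S) (adjoin_powers x L)"
proof -
  note P = stable_powers_below[OF assms, of x]
  note zero = stable_subgroup_0[OF assms]
  show ?thesis
    unfolding stable_subgroup_def
  proof (intro conjI ballI)
    show "0 \<in> adjoin_powers x L"
      using stable_subgroup_0[OF P] by (auto simp: adjoin_powers_def)
  next
    fix a b assume "a \<in> adjoin_powers x L" "b \<in> adjoin_powers x L"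
    then obtain i j where "a \<in> powers_below x L i" "b \<in> powers_below x L j"
      by (auto simp: adjoin_powers_def)
    then have "a \<in> powers_below x L (max i j)" "b \<in> powers_below x L (max i j)"
      using powers_below_mono[OF zero, of i "max i j" x] powers_below_mono[OF zero, of j "max i j" x]
      by auto
    then show "a - b \<in> adjoin_powers x L"
      using stable_subgroup_diff[OF P] by (auto simp: adjoin_powers_def)
  next
    fix s a assume "s \<in> insert x S" "a \<in> adjoin_powers x L"
    then obtain i where i: "a \<in> powers_below x L i" by (auto simp: adjoin_powers_def)
    show "s *s a \<in> adjoin_powers x L"
    proof (cases "s = x")
      case True
      then show ?thesis
        using powers_below_scale[OF zero i] unfolding adjoin_powers_def by blast
    next
      case False
      then show ?thesis
        using stable_subgroup_scale[OF P _ i] \<open>s \<in> insert x S\<close> unfolding adjoin_powers_def by blast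
    qed
  qed
qed

lemma stable_leading:
  assumes "stable_subgroup S L" "stable_subgroup S U"
  shows "stable_subgroup S (leading x L i U)"
proof -
  note P = stable_powers_below[OF assms(1), of x i]
  note L = assms(1) and U = assms(2)
  show ?thesis
    unfolding stable_subgroup_def
  proof (intro conjI ballI)
    have "0 + x ^ i *s 0 \<in> U" using stable_subgroup_0[OF U] by simp
    then show "0 \<in> leading x L i U"
      unfolding leading_def using stable_subgroup_0[OF P] stable_subgroup_0[OF L] by blast
  next
    fix a b assume "a \<in> leading x L i U" "b \<in> leading x L i U"
    then obtain a' b' where *: "a \<in> L" "b \<in> L" "a' \<in> powers_below x L i" "b' \<in> powers_below x L i"
      "a' + x ^ i *s a \<in> U" "b' + x ^ i *s b \<in> U"
      by (auto simp: leading_def)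
    have "(a' - b') + x ^ i *s (a - b) = (a' + x ^ i *s a) - (b' + x ^ i *s b)"
      by (simp add: scale_right_diff_distrib)
    then have "(a' - b') + x ^ i *s (a - b) \<in> U"
      using * stable_subgroup_diff[OF U] by metis
    then show "a - b \<in> leading x L i U"
      unfolding leading_def using * stable_subgroup_diff[OF P] stable_subgroup_diff[OF L] by blast
  next
    fix s a assume s: "s \<in> S" and "a \<in> leading x L i U"
    then obtain a' where *: "a \<in> L" "a' \<in> powers_below x L i" "a' + x ^ i *s a \<in> U"
      by (auto simp: leading_def)
    have "s *s a' + x ^ i *s (s *s a) = s *s (a' + x ^ i *s a)"
      by (simp add: scale_right_distrib mult.commute)
    then have "s *s a' + x ^ i *s (s *s a) \<in> U"
      using * stable_subgroup_scale[OF U s] by simp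
    then show "s *s a \<in> leading x L i U"
      unfolding leading_def using * stable_subgroup_scale[OF P s] stable_subgroup_scale[OF L s] by blast
  qed
qed

lemma leading_mono_Suc:
  assumes "0 \<in> L" "stable_subgroup (insert x S) U"
  shows "leading x L i U \<subseteq> leading x L (Suc i) U"
proof
  fix l assume "l \<in> leading x L i U"
  then obtain a where a: "l \<in> L" "a \<in> powers_below x L i" "a + x ^ i *s l \<in> U"
    by (auto simp: leading_def)
  have "x *s a + x ^ Suc i *s l = x *s (a + x ^ i *s l)"
    by (simp add: scale_right_distrib)
  then have "x *s a + x ^ Suc i *s l \<in> U"
    using stable_subgroup_scale[OF assms(2) _ a(3)] by simp
  then show "l \<in> leading x L (Suc i) U"
    unfolding leading_def using a powers_below_scale[OF assms(1) a(2)] by blast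
qed

lemma leading_mono: "U \<subseteq> U' \<Longrightarrow> leading x L i U \<subseteq> leading x L i U'"
  unfolding leading_def by blast

text \<open>Induction on the degree: some element of \<open>U\<close> has the same leading
  coefficient, and subtracting it lowers the degree. Non-unique expressions do no harm because
  \<open>leading\<close> accepts any of them.\<close>

lemma subset_if_leading_subset:
  assumes "stable_subgroup S L" "stable_subgroup (insert x S) U" "stable_subgroup (insert x S) U'"
    and "U \<subseteq> U'" "\<And>i. leading x L i U' \<subseteq> leading x L i U"
  shows "u \<in> U' \<Longrightarrow> u \<in> powers_below x L i \<Longrightarrow> u \<in> U"
proof (induction i arbitrary: u)
  case 0
  then show ?case using stable_subgroup_0[OF assms(2)] by simp
next
  case (Suc i)
  then obtain a l where u: "a \<in> powers_below x L i" "l \<in> L" "u = a + x ^ i *s l"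
    by auto
  then have "l \<in> leading x L i U'" using Suc.prems by (auto simp: leading_def)
  then have "l \<in> leading x L i U" using assms(5) by blast
  then obtain b where b: "b \<in> powers_below x L i" "b + x ^ i *s l \<in> U"
    by (auto simp: leading_def)
  have "u - (b + x ^ i *s l) \<in> U'"
    using Suc.prems b assms(4) stable_subgroup_diff[OF assms(3)] by blast
  moreover have "u - (b + x ^ i *s l) = a - b" using u by simp
  moreover have "a - b \<in> powers_below x L i"
    using u b stable_subgroup_diff[OF stable_powers_below[OF assms(1)]] by blast
  ultimately have "a - b \<in> U" using Suc.IH by simp
  then have "(a - b) + (b + x ^ i *s l) \<in> U"
    using b stable_subgroup_add[OF assms(2)] by blast
  then show ?case using u by simp
qed

text \<open>Hilbert's basis theorem, for modules: the leading coefficients of a chain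
  stabilise along the diagonal, and then in all degrees at once.\<close>

lemma acc_adjoin_powers:
  assumes L: "stable_subgroup S L" and acc: "acc_within S L"
  shows "acc_within (insert x S) (adjoin_powers x L)"
  unfolding acc_within_def
proof (intro allI impI, elim conjE)
  fix U :: "nat \<Rightarrow> 'b set"
  assume U: "\<forall>n. stable_subgroup (insert x S) (U n) \<and> U n \<subseteq> adjoin_powers x L" and inc: "incseq U"
  have U_stable: "stable_subgroup (insert x S) (U n)" for n using U by blast
  define W where "W i n = leading x L i (U n)" for i n
  have W_mono: "W i n \<subseteq> W j m" if "i \<le> j" "n \<le> m" for i j n m
  proof -
    have "W i n \<subseteq> W j n"
      unfolding W_def
      by (rule lift_Suc_mono_le[of "\<lambda>i. leading x L i (U n)",
            OF leading_mono_Suc[OF stable_subgroup_0[OF L] U_stable] that(1)])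
    also have "\<dots> \<subseteq> W j m"
      unfolding W_def by (rule leading_mono[OF incseqD[OF inc that(2)]])
    finally show ?thesis .
  qed
  have W_stable: "stable_subgroup S (W i n)" for i n
    unfolding W_def by (rule stable_leading[OF L stable_subgroup_mono[OF U_stable subset_insertI]])
  have W_sub: "W i n \<subseteq> L" for i n
    unfolding W_def leading_def by blast
  have "\<exists>d. \<forall>n\<ge>d. W n n = W d d"
    by (rule acc[unfolded acc_within_def, rule_format])
      (use W_stable W_sub W_mono in \<open>blast intro: incseq_SucI le_SucI order_refl\<close>)
  then obtain d where d: "\<And>n. n \<ge> d \<Longrightarrow> W n n = W d d" by blast
  have "\<exists>d. \<forall>n\<ge>d. W i n = W i d" for i
    by (rule acc[unfolded acc_within_def, rule_format])
      (use W_stable W_sub W_mono in \<open>blast intro: incseq_SucI le_SucI order_refl\<close>)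
  then have "\<forall>i. \<exists>d. \<forall>n\<ge>d. W i n = W i d" ..
  from choice[OF this] obtain e where e: "\<And>i n. n \<ge> e i \<Longrightarrow> W i n = W i (e i)" by blast
  \<comment> \<open>Only finitely many \<open>e i\<close> can be taken into account. For a row
    \<open>i\<close> beyond \<open>d\<close>, the entry \<open>W i n\<close> lies in a later
    diagonal entry, which equals \<open>W d d\<close> and hence lies in
    \<open>W i N\<close>.\<close>
  define N where "N = Max (insert d (e ` {..d}))"
  have N: "d \<le> N" "\<And>i. i \<le> d \<Longrightarrow> e i \<le> N"
    unfolding N_def by (simp_all del: Max_insert)
  have W_eq: "W i n \<subseteq> W i N" if "n \<ge> N" for i n
  proof (cases "i \<le> d")
    case True
    then have "e i \<le> N" by (rule N)
    then show ?thesis using e[of i n] e[of i N] that by simp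
  next
    case False
    then have "W i n \<subseteq> W (max i n) (max i n)" "W d d \<subseteq> W i N"
      using N(1) by (intro W_mono; simp)+
    moreover have "W (max i n) (max i n) = W d d" using False by (intro d) simp
    ultimately show ?thesis by blast
  qed
  have "U n = U N" if "n \<ge> N" for n
  proof
    show sub: "U N \<subseteq> U n" using inc that by (rule incseqD)
    show "U n \<subseteq> U N"
    proof
      fix u assume u: "u \<in> U n"
      then obtain i where "u \<in> powers_below x L i"
        using U unfolding adjoin_powers_def by blast
      then show "u \<in> U N"
        using subset_if_leading_subset[OF L U_stable U_stable sub W_eq[OF that, unfolded W_def] u] by blast
    qed
  qed
  then show "\<exists>d. \<forall>n\<ge>d. U n = U d" by blast
qed

end

text \<open>Among the independent sets contained in some member, one of maximal size spans every
  later member.\<close>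

lemma (in vector_space) subspace_chain_stabilizes:
  assumes "finite B" "\<And>n. subspace (U n)" "\<And>n. U n \<subseteq> span B" "incseq U"
  shows "\<exists>d. \<forall>n\<ge>d. U n = U d"
proof -
  have fin: "finite b \<and> card b \<le> card B" if "independent b" "b \<subseteq> U n" for b n
    using independent_span_bound[OF assms(1) that(1)] that(2) assms(3) by blast
  define Q where "Q k \<longleftrightarrow> (\<exists>n b. b \<subseteq> U n \<and> independent b \<and> card b = k)" for k
  have "Q 0" unfolding Q_def by (intro exI[of _ 0] exI[of _ "{}"]) (simp add: independent_empty)
  moreover have "\<And>k. Q k \<Longrightarrow> k \<le> card B" unfolding Q_def using fin by blast
  ultimately have "Q (Greatest Q)" and max: "\<And>k. Q k \<Longrightarrow> k \<le> Greatest Q"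
    by (auto intro: GreatestI_nat Greatest_le_nat)
  then obtain d b where b: "b \<subseteq> U d" "independent b" "card b = Greatest Q"
    unfolding Q_def by blast
  have *: "U n \<subseteq> span b" if "n \<ge> d" for n
  proof
    fix v assume v: "v \<in> U n"
    show "v \<in> span b"
    proof (rule ccontr)
      assume nv: "v \<notin> span b"
      then have "independent (insert v b)" "v \<notin> b"
        using b by (auto simp: independent_insert span_base)
      moreover have "insert v b \<subseteq> U n" using v b incseqD[OF assms(4) that] by blast
      ultimately have "Q (Suc (card b))"
        unfolding Q_def using fin[OF b(2,1)] by (intro exI[of _ n] exI[of _ "insert v b"]) simp
      then show False using max b by fastforce
    qed
  qed
  have "span b \<subseteq> U d" using b assms(2) by (intro span_minimal)
  then have "U n = U d" if "n \<ge> d" for n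
    using *[OF that] incseqD[OF assms(4) that] by blast
  then show ?thesis by blast
qed

section \<open>Modules over a monoid algebra\<close>

definition cst :: "'k \<Rightarrow> ('q::comm_monoid_add \<Rightarrow>\<^sub>0 'k::field)" where
  "cst c = Poly_Mapping.single 0 c"

lemma cst_0 [simp]: "cst 0 = 0"
  and cst_1 [simp]: "cst 1 = 1"
  and cst_mult: "cst (a * b) = cst a * cst b"
  and cst_minus: "cst (- a) = - cst a"
  and cst_diff: "cst (a - b) = cst a - cst b"
  by (simp_all add: cst_def single_add mult_single single_uminus single_diff)

lemma cst_power: "cst (a ^ n) = cst a ^ n"
  by (induction n) (simp_all add: cst_mult)

lemma cst_of_nat: "cst (of_nat n) = of_nat n"
  by (simp add: cst_def)

abbreviation monomials :: "('q::comm_monoid_add \<Rightarrow>\<^sub>0 'k::field) set" where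
  "monomials \<equiv> range monoid_monomial"

lemma one_in_monomials: "1 \<in> monomials"
  by (intro image_eqI[of _ _ 0]) (simp_all add: monoid_monomial_def)

lemma monoid_monomial_add:
  "(monoid_monomial (p + q) :: 'q::comm_monoid_add \<Rightarrow>\<^sub>0 'k::field)
    = monoid_monomial p * monoid_monomial q"
  by (simp add: monoid_monomial_def mult_single)

lemma mult_in_monomials: "x \<in> monomials \<Longrightarrow> y \<in> monomials \<Longrightarrow> x * y \<in> monomials"
  by (auto simp: monoid_monomial_add [symmetric])

lemma power_in_monomials: "x \<in> monomials \<Longrightarrow> x ^ n \<in> monomials"
  by (induction n) (auto intro: one_in_monomials mult_in_monomials)

lemma poly_mapping_expand:
  "r = (\<Sum>q\<in>Poly_Mapping.keys r. cst (Poly_Mapping.lookup r q) * monoid_monomial q)"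
  by (rule poly_mapping_eqI)
    (simp add: cst_def monoid_monomial_def mult_single lookup_sum lookup_single when_def
      sum.delta in_keys_iff)

text \<open>An expression with the fewest terms is taken: a term in \<open>Y\<close> could be
  dropped, and two terms proportional modulo \<open>Y\<close> could be merged. It serves both for
  homogeneous elements modulo a submodule and for monomials of the algebra modulo nilpotent
  elements.\<close>

lemma (in vector_space) reduced_representation:
  assumes G: "span G = UNIV" and Y: "subspace Y"
  shows "\<exists>I r. finite I \<and> I \<subseteq> G \<and> m - (\<Sum>u\<in>I. scale (r u) u) \<in> Y \<and>
    (\<forall>u\<in>I. r u \<noteq> 0 \<and> u \<notin> Y) \<and> (\<forall>u\<in>I. \<forall>v\<in>I. u \<noteq> v \<longrightarrow> (\<forall>c. u - scale c v \<notin> Y))"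
proof -
  define Q where "Q I r \<longleftrightarrow> finite I \<and> I \<subseteq> G \<and> m - (\<Sum>u\<in>I. scale (r u) u) \<in> Y" for I r
  have "m \<in> span G" using G by simp
  then obtain I0 r0 where "finite I0" "I0 \<subseteq> G" "m = (\<Sum>u\<in>I0. scale (r0 u) u)"
    unfolding span_explicit by blast
  then have "Q I0 r0" unfolding Q_def using subspace_0[OF Y] by simp
  then have "\<exists>k I r. Q I r \<and> card I = k" by blast
  then obtain I r where I: "Q I r" "card I = (LEAST k. \<exists>I r. Q I r \<and> card I = k)"
    using LeastI_ex[of "\<lambda>k. \<exists>I r. Q I r \<and> card I = k"] by blast
  have min: "card I \<le> card J" if "Q J s" for J s
    unfolding I(2) using that by (intro Least_le) blast
  have fin: "finite I" "I \<subseteq> G" "m - (\<Sum>u\<in>I. scale (r u) u) \<in> Y"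
    using I unfolding Q_def by auto
  have smaller: "\<not> Q (I - {u}) s" if "u \<in> I" for u s
    using min[of "I - {u}" s] card_Diff1_less[OF fin(1) that] by linarith
  have rem: "(\<Sum>w\<in>I. scale (r w) w) = scale (r u) u + (\<Sum>w\<in>I - {u}. scale (r w) w)"
    if "u \<in> I" for u
    using fin(1) that by (simp add: sum.remove)
  have not_Y: "scale (r u) u \<notin> Y" if u: "u \<in> I" for u
  proof
    assume "scale (r u) u \<in> Y"
    then have "(m - (\<Sum>u\<in>I. scale (r u) u)) + scale (r u) u \<in> Y"
      using subspace_add[OF Y] fin by blast
    then have "Q (I - {u}) r"
      unfolding Q_def using fin by (auto simp: rem[OF u])
    then show False using smaller[OF u] by blast
  qed
  show ?thesis
  proof (intro exI conjI ballI impI allI)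
    show "finite I" "I \<subseteq> G" "m - (\<Sum>u\<in>I. scale (r u) u) \<in> Y" by (rule fin)+
    show "r u \<noteq> 0" if "u \<in> I" for u
      using not_Y[OF that] subspace_0[OF Y] by auto
    show "u \<notin> Y" if "u \<in> I" for u
      using not_Y[OF that] subspace_scale[OF Y] by auto
    show "u - scale c v \<notin> Y" if u: "u \<in> I" and v: "v \<in> I" and "u \<noteq> v" for u v c
    proof
      assume "u - scale c v \<in> Y"
      then have in_Y: "(m - (\<Sum>u\<in>I. scale (r u) u)) + scale (r u) (u - scale c v) \<in> Y"
        using subspace_add[OF Y] subspace_scale[OF Y] fin by blast
      \<comment> \<open>Modulo \<open>Y\<close> the term of \<open>u\<close> is
        \<open>r u * c\<close> times \<open>v\<close>, so the coefficient of \<open>v\<close>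
        absorbs it.\<close>
      define s where "s = r(v := r v + r u * c)"
      have "(\<Sum>w\<in>I - {u}. scale (s w) w)
          = scale (s v) v + (\<Sum>w\<in>I - {u} - {v}. scale (s w) w)"
        using fin(1) v \<open>u \<noteq> v\<close> by (intro sum.remove) auto
      also have "(\<Sum>w\<in>I - {u} - {v}. scale (s w) w) = (\<Sum>w\<in>I - {u} - {v}. scale (r w) w)"
        by (intro sum.cong) (auto simp: s_def)
      also have "scale (s v) v + \<dots> = scale (r u * c) v + (\<Sum>w\<in>I - {u}. scale (r w) w)"
        using fin(1) v \<open>u \<noteq> v\<close>
        by (subst sum.remove[of "I - {u}" v]) (auto simp: s_def scale_left_distrib)
      finally have "m - (\<Sum>w\<in>I - {u}. scale (s w) w)
          = (m - (\<Sum>u\<in>I. scale (r u) u)) + scale (r u) (u - scale c v)"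
        by (simp add: rem[OF u] scale_right_diff_distrib)
      then have "Q (I - {u}) s"
        unfolding Q_def using fin in_Y by (metis Diff_subset finite_Diff subset_trans)
      then show False using smaller[OF u] by blast
    qed
  qed
qed

locale monoid_algebra_module = operator_module scale
  for scale :: "('q::comm_monoid_add \<Rightarrow>\<^sub>0 'k::field) \<Rightarrow> 'm::ab_group_add \<Rightarrow> 'm"  (infixr \<open>*s\<close> 75)
begin

sublocale const: vector_space "const_scale scale"
  by (rule vector_space_const_scale) unfold_locales

lemma const_scale_eq: "const_scale scale c m = cst c *s m"
  by (simp add: const_scale_def cst_def)

lemma cst_scale_cancel: "c \<noteq> 0 \<Longrightarrow> cst (inverse c) *s cst c *s m = m"
  by (simp flip: cst_mult)

lemma cst_scale_in_iff:
  assumes "subspace N" "c \<noteq> 0"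
  shows "cst c *s m \<in> N \<longleftrightarrow> m \<in> N"
  using subspace_scale[OF assms(1), of m "cst c"]
    subspace_scale[OF assms(1), of "cst c *s m" "cst (inverse c)"] cst_scale_cancel[OF assms(2)]
  by auto

lemma stable_subgroup_cst_iff: "stable_subgroup (range cst) U \<longleftrightarrow> const.subspace U"
proof
  assume U: "stable_subgroup (range cst) U"
  show "const.subspace U"
    by (intro const.subspaceI)
      (auto simp: const_scale_eq stable_subgroup_0[OF U] stable_subgroup_add[OF U]
        stable_subgroup_scale[OF U])
next
  assume "const.subspace U"
  then show "stable_subgroup (range cst) U"
    unfolding stable_subgroup_def
    using const.subspace_0 const.subspace_diff const.subspace_scale by (auto simp: const_scale_eq[symmetric])
qed

lemma subspaceI_monomials:
  assumes "const.subspace U" "\<And>x u. x \<in> monomials \<Longrightarrow> u \<in> U \<Longrightarrow> x *s u \<in> U"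
  shows "subspace U"
proof (rule subspaceI)
  show "0 \<in> U" "\<And>x y. x \<in> U \<Longrightarrow> y \<in> U \<Longrightarrow> x + y \<in> U"
    using assms(1) const.subspace_0 const.subspace_add by auto
  fix r u assume u: "u \<in> U"
  have "r *s u = (\<Sum>q\<in>Poly_Mapping.keys r.
      const_scale scale (Poly_Mapping.lookup r q) (monoid_monomial q *s u))"
    by (subst poly_mapping_expand[of r]) (simp add: scale_sum_left const_scale_eq)
  also have "\<dots> \<in> U"
    using u assms by (intro const.subspace_sum const.subspace_scale) auto
  finally show "r *s u \<in> U" .
qed

lemma subspace_imp_const_subspace: "subspace U \<Longrightarrow> const.subspace U"
  using subspace_imp_stable_subgroup stable_subgroup_cst_iff by blast

text \<open>Induction over the generators of \<open>Q\<close>: the finite-dimensional span of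
  \<open>B\<close> satisfies the chain condition for the constants alone, and the basis theorem
  adjoins each generator. The final set contains \<open>B\<close> and is a submodule, hence is
  everything.\<close>

lemma acc_submodules:
  assumes Q: "fg_monoid (UNIV :: 'q set)" and B: "finite B" "span B = UNIV"
  shows "acc_within (range cst \<union> monomials) UNIV"
proof -
  obtain G where G: "finite G" "UNIV = {sum_list xs | xs. set xs \<subseteq> (G :: 'q set)}"
    using Q unfolding fg_monoid_def by blast
  have "\<exists>L. B \<subseteq> L \<and> stable_subgroup (range cst \<union> monoid_monomial ` G) L \<and>
      acc_within (range cst \<union> monoid_monomial ` G) L"
    using G(1)
  proof induction
    case empty
    have "acc_within (range cst) (const.span B)"
      unfolding acc_within_def
      using const.subspace_chain_stabilizes[OF B(1)] by (auto simp: stable_subgroup_cst_iff)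
    then show ?case
      by (intro exI[of _ "const.span B"]) (auto simp: stable_subgroup_cst_iff const.span_base)
  next
    case (insert g G)
    then obtain L where "B \<subseteq> L" "stable_subgroup (range cst \<union> monoid_monomial ` G) L"
      "acc_within (range cst \<union> monoid_monomial ` G) L" by blast
    then show ?case
      using stable_adjoin_powers acc_adjoin_powers subset_adjoin_powers[of L "monoid_monomial g"]
      by (intro exI[of _ "adjoin_powers (monoid_monomial g) L"]) auto
  qed
  then obtain L where L: "B \<subseteq> L" "stable_subgroup (range cst \<union> monoid_monomial ` G) L"
      "acc_within (range cst \<union> monoid_monomial ` G) L" by blast
  have sums: "monoid_monomial (sum_list xs) *s u \<in> L" if "set xs \<subseteq> G" "u \<in> L" for xs u
    using that
  proof (induction xs)
    case Nil
    then show ?case by (simp add: monoid_monomial_def)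
  next
    case (Cons g xs)
    then have "monoid_monomial g *s (monoid_monomial (sum_list xs) *s u) \<in> L"
      by (intro stable_subgroup_scale[OF L(2), of "monoid_monomial g"]) auto
    then show ?case by (simp add: monoid_monomial_add)
  qed
  have mono: "x *s u \<in> L" if x: "x \<in> monomials" and u: "u \<in> L" for x u
  proof -
    obtain q where "x = monoid_monomial q" using x by blast
    moreover obtain xs where "set xs \<subseteq> G" "q = sum_list xs" using G(2) by blast
    ultimately show ?thesis using sums u by simp
  qed
  have "subspace L"
    using L(2) stable_subgroup_mono[OF L(2)] mono
    by (intro subspaceI_monomials) (auto simp: stable_subgroup_cst_iff[symmetric])
  then have "L = UNIV"
    using span_minimal[OF L(1)] B by auto
  moreover have "acc_within (range cst \<union> monomials) L"
    using L(3) unfolding acc_within_def by (meson Un_mono image_mono order_refl stable_subgroup_mono subset_UNIV)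
  ultimately show ?thesis by simp
qed

lemma submodule_chain_stabilizes:
  assumes "fg_monoid (UNIV :: 'q set)" "finite B" "span B = UNIV"
    and "\<And>n. subspace (U n)" "incseq U"
  shows "\<exists>d. \<forall>n\<ge>d. U n = U d"
  using acc_submodules[OF assms(1-3)] assms(4,5) subspace_imp_stable_subgroup
  unfolding acc_within_def by blast

lemma ex_maximal_submodule:
  assumes "fg_monoid (UNIV :: 'q set)" "finite B" "span B = UNIV"
    and F: "\<And>U. U \<in> F \<Longrightarrow> subspace U" "F \<noteq> {}"
  shows "\<exists>U\<in>F. \<forall>V\<in>F. U \<subseteq> V \<longrightarrow> V = U"
proof (rule ccontr)
  assume "\<not> ?thesis"
  then have next_ex: "\<And>U. U \<in> F \<Longrightarrow> \<exists>V. V \<in> F \<and> U \<subset> V" by blast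
  obtain U where U: "\<And>n. U n \<in> F \<and> U n \<subset> U (Suc n)"
    using dependent_nat_choice[of "\<lambda>_ U. U \<in> F" "\<lambda>_. (\<subset>)"] F(2) next_ex by blast
  then have "incseq U" by (auto intro: incseq_SucI)
  then obtain d where "\<And>n. n \<ge> d \<Longrightarrow> U n = U d"
    using submodule_chain_stabilizes[OF assms(1-3), of U] U F(1) by blast
  from this[of "Suc d"] show False using U[of d] by auto
qed

end

section \<open>Binomial submodules of finely graded modules\<close>

locale finely_graded_module = monoid_algebra_module scale
  for scale :: "('q::comm_monoid_add \<Rightarrow>\<^sub>0 'k::field) \<Rightarrow> 'm::ab_group_add \<Rightarrow> 'm"  (infixr \<open>*s\<close> 75) +
  fixes act :: "'q \<Rightarrow> 't \<Rightarrow> 't" and T :: "'t set" and D :: "'t \<Rightarrow> 'm set"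
  assumes q_module: "q_module act T" and fine: "finely_graded_by scale act T D"
begin

definition Homog :: "'m set" where
  "Homog = insert 0 (\<Union>t\<in>T. D t)"

definition Bin :: "'m set" where
  "Bin = {a + b | a b. a \<in> Homog \<and> b \<in> Homog}"

text \<open>Taking all binomials of \<open>N\<close> as generators avoids carrying a chosen
  generating set. Here 0 counts as a binomial.\<close>

definition binsub :: "'m set \<Rightarrow> bool" where
  "binsub N \<longleftrightarrow> subspace N \<and> N \<subseteq> span (N \<inter> Bin)"

lemma D_const_subspace: "t \<in> T \<Longrightarrow> const.subspace (D t)"
  using fine unfolding finely_graded_by_def graded_by_def by blast

lemma D_monomial: "t \<in> T \<Longrightarrow> m \<in> D t \<Longrightarrow> monoid_monomial q *s m \<in> D (act q t)"
  using fine unfolding finely_graded_by_def graded_by_def by blast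

lemma act_in_T: "t \<in> T \<Longrightarrow> act q t \<in> T"
  using q_module unfolding q_module_def by blast

lemma D_line:
  assumes t: "t \<in> T" and u: "u \<in> D t" "u \<noteq> 0" and v: "v \<in> D t"
  obtains c where "v = cst c *s u"
proof -
  obtain B0 where B0: "finite B0" "const.span B0 = D t"
    using fine t unfolding finely_graded_by_def graded_by_def by blast
  have dim: "const.dim (D t) \<le> 1"
    using fine t unfolding finely_graded_by_def by blast
  obtain B where B: "B \<subseteq> D t" "const.independent B" "D t \<subseteq> const.span B" "card B = const.dim (D t)"
    using const.basis_exists[of "D t"] by blast
  \<comment> \<open>The finite spanning set makes the basis finite, so that \<open>card B\<close>
    measures it.\<close>
  have "finite B"
    using const.independent_span_bound[OF B0(1) B(2)] B(1) B0(2) by blast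
  moreover have "B \<noteq> {}"
    using B(3) u by auto
  ultimately have "card B = 1"
    using dim B(4) by (metis One_nat_def card_0_eq le_SucE le_zero_eq)
  then obtain e where "B = {e}" by (rule card_1_singletonE)
  then have "D t \<subseteq> range (\<lambda>c. cst c *s e)"
    using B(3) by (simp add: const.span_singleton const_scale_eq)
  then obtain a b where ab: "u = cst a *s e" "v = cst b *s e"
    using u v by blast
  with u have "a \<noteq> 0" by auto
  then have "v = cst (b * inverse a) *s u"
    by (simp add: ab mult.assoc flip: cst_mult)
  then show thesis by (rule that)
qed

lemma zero_Homog: "0 \<in> Homog"
  by (simp add: Homog_def)

lemma D_cst: "t \<in> T \<Longrightarrow> u \<in> D t \<Longrightarrow> cst c *s u \<in> D t"
  using const.subspace_scale[OF D_const_subspace] by (simp only: const_scale_eq)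

lemma cst_Homog: "u \<in> Homog \<Longrightarrow> cst c *s u \<in> Homog"
  unfolding Homog_def by (auto dest: D_cst)

lemma monomial_Homog: "x \<in> monomials \<Longrightarrow> u \<in> Homog \<Longrightarrow> x *s u \<in> Homog"
  unfolding Homog_def by (auto dest: D_monomial intro: act_in_T)

lemma Homog_subset_Bin: "Homog \<subseteq> Bin"
proof
  fix u assume "u \<in> Homog"
  moreover have "u = u + 0" by simp
  ultimately show "u \<in> Bin" unfolding Bin_def using zero_Homog by blast
qed

lemma Homog_add_Bin: "u \<in> Homog \<Longrightarrow> v \<in> Homog \<Longrightarrow> u + v \<in> Bin"
  unfolding Bin_def by blast

lemma Homog_diff_Bin: "u \<in> Homog \<Longrightarrow> v \<in> Homog \<Longrightarrow> u - cst c *s v \<in> Bin"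
  using Homog_add_Bin[OF _ cst_Homog[of v "- c"]] by (simp add: cst_minus)

lemma binsub_subspace: "binsub N \<Longrightarrow> subspace N"
  by (simp add: binsub_def)

lemma binsub_subset_span: "binsub N \<Longrightarrow> N \<subseteq> span (N \<inter> Bin)"
  by (simp add: binsub_def)

lemma binsubI: "subspace N \<Longrightarrow> N \<subseteq> span (N \<inter> Bin) \<Longrightarrow> binsub N"
  by (simp add: binsub_def)

lemma binsub_span: "B \<subseteq> Bin \<Longrightarrow> binsub (span B)"
  by (intro binsubI subspace_span span_mono) (simp add: span_superset)

lemma is_binomial_iff: "is_binomial T D b \<longleftrightarrow> b \<in> Bin - {0}"
proof -
  have mono: "is_monomial T D a \<longleftrightarrow> a \<in> Homog - {0}" for a
    unfolding is_monomial_def Homog_def by blast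
  have "b \<in> Bin" if "b \<in> Homog" for b using that Homog_subset_Bin by blast
  moreover have "b \<in> Homog \<or> (\<exists>m\<in>Homog - {0}. \<exists>m'\<in>Homog - {0}. b = m + m')" if b: "b \<in> Bin"
  proof -
    obtain u v where uv: "u \<in> Homog" "v \<in> Homog" "b = u + v" using b unfolding Bin_def by blast
    then show ?thesis by (cases "u = 0"; cases "v = 0") auto
  qed
  ultimately show ?thesis
    unfolding is_binomial_def mono using Homog_add_Bin by blast
qed

lemma binomial_submodule_iff: "binomial_submodule scale T D N \<longleftrightarrow> binsub N"
proof
  assume "binomial_submodule scale T D N"
  then show "binsub N"
    unfolding binomial_submodule_def is_binomial_iff using binsub_span by blast
next
  assume N: "binsub N"
  have "N \<inter> Bin \<subseteq> span (N \<inter> Bin - {0})"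
    using span_base[of _ "N \<inter> Bin - {0}"] span_zero by blast
  then have "span (N \<inter> Bin) \<subseteq> span (N \<inter> Bin - {0})"
    by (intro span_minimal subspace_span)
  moreover have "span (N \<inter> Bin - {0}) \<subseteq> N"
    by (intro span_minimal binsub_subspace[OF N]) blast
  ultimately have eq: "N = span (N \<inter> Bin - {0})"
    using binsub_subset_span[OF N] by blast
  show "binomial_submodule scale T D N"
    unfolding binomial_submodule_def is_binomial_iff
    by (intro exI[of _ "N \<inter> Bin - {0}"] conjI eq) blast
qed

section \<open>Homogeneous components and projections that preserve a binomial submodule\<close>

definition decomposes :: "'m \<Rightarrow> ('t \<Rightarrow> 'm) \<Rightarrow> bool" where
  "decomposes m f \<longleftrightarrow> finite {t. f t \<noteq> 0} \<and> (\<forall>t\<in>T. f t \<in> D t) \<and> (\<forall>t. t \<notin> T \<longrightarrow> f t = 0) \<and>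
     m = (\<Sum>t | f t \<noteq> 0. f t)"

definition comp :: "'m \<Rightarrow> 't \<Rightarrow> 'm" where
  "comp m = (THE f. decomposes m f)"

lemma ex1_decomposes: "\<exists>!f. decomposes m f"
proof -
  have "internal_direct_sum T D"
    using fine unfolding finely_graded_by_def graded_by_def by blast
  then show ?thesis unfolding internal_direct_sum_def decomposes_def by (rule spec)
qed

lemma decomposes_comp: "decomposes m (comp m)"
  unfolding comp_def by (rule theI'[where P = "decomposes m", OF ex1_decomposes])

lemma comp_eqI:
  assumes "decomposes m f"
  shows "comp m = f"
  unfolding comp_def by (rule the1_equality[where P = "decomposes m", OF ex1_decomposes assms])

definition proj :: "'t set \<Rightarrow> 'm \<Rightarrow> 'm" where
  "proj S m = (\<Sum>t | comp m t \<noteq> 0. if t \<in> S then comp m t else 0)"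

lemma comp_add: "comp (m + n) = (\<lambda>t. comp m t + comp n t)"
proof (rule comp_eqI)
  note m = decomposes_comp[of m, unfolded decomposes_def]
  note n = decomposes_comp[of n, unfolded decomposes_def]
  let ?A = "{t. comp m t \<noteq> 0} \<union> {t. comp n t \<noteq> 0}"
  have fin: "finite ?A" using m n by simp
  have sub: "{t. comp m t + comp n t \<noteq> 0} \<subseteq> ?A" by auto
  have "m = (\<Sum>t\<in>?A. comp m t)"
    using m by (intro trans[OF _ sum.mono_neutral_left[OF fin]]) auto
  moreover have "n = (\<Sum>t\<in>?A. comp n t)"
    using n by (intro trans[OF _ sum.mono_neutral_left[OF fin]]) auto
  ultimately have "m + n = (\<Sum>t\<in>?A. comp m t + comp n t)"
    by (simp add: sum.distrib)
  also have "\<dots> = (\<Sum>t | comp m t + comp n t \<noteq> 0. comp m t + comp n t)"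
    by (rule sum.mono_neutral_right[OF fin sub]) auto
  finally show "decomposes (m + n) (\<lambda>t. comp m t + comp n t)"
    unfolding decomposes_def
    using m n finite_subset[OF sub fin] const.subspace_add[OF D_const_subspace] by auto
qed

lemma proj_superset:
  assumes "finite A" "{t. comp m t \<noteq> 0} \<subseteq> A"
  shows "proj S m = (\<Sum>t\<in>A. if t \<in> S then comp m t else 0)"
  unfolding proj_def by (rule sum.mono_neutral_left[OF assms]) auto

lemma additive_proj: "additive (proj S)"
proof
  fix m n
  let ?A = "{t. comp m t \<noteq> 0} \<union> {t. comp n t \<noteq> 0}"
  have fin: "finite ?A"
    using decomposes_comp[of m] decomposes_comp[of n] unfolding decomposes_def by simp
  show "proj S (m + n) = proj S m + proj S n"
    by (subst (1 2 3) proj_superset[OF fin])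
      (auto simp: comp_add simp flip: sum.distrib intro!: sum.cong)
qed

lemma proj_homogeneous:
  assumes "t \<in> T" "u \<in> D t"
  shows "proj S u = (if t \<in> S then u else 0)"
proof -
  have "comp u = (\<lambda>s. if s = t then u else 0)"
  proof (rule comp_eqI)
    have "{s. (if s = t then u else 0) \<noteq> 0} = (if u = 0 then {} else {t})" by auto
    then show "decomposes u (\<lambda>s. if s = t then u else 0)"
      unfolding decomposes_def
      using assms const.subspace_0[OF D_const_subspace] by auto
  qed
  then have "proj S u = (\<Sum>s\<in>{t}. if s \<in> S then if s = t then u else 0 else 0)"
    by (subst proj_superset[of "{t}"]) (auto split: if_splits)
  then show ?thesis by simp
qed

lemma const_span_Homog: "const.span Homog = UNIV"
proof -
  have "m \<in> const.span Homog" for m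
  proof -
    have "m = (\<Sum>t | comp m t \<noteq> 0. comp m t)" "\<And>t. comp m t \<in> Homog"
      using decomposes_comp[of m] unfolding decomposes_def Homog_def by auto
    then show ?thesis
      by (metis const.span_base const.span_sum)
  qed
  then show ?thesis by blast
qed

lemma span_Homog: "span Homog = UNIV"
  using const.span_minimal[OF span_superset subspace_imp_const_subspace[OF subspace_span], of Homog]
    const_span_Homog by blast

text \<open>The projection of a binomial in \<open>N\<close> is the binomial itself, \<open>0\<close>, or one of its two terms;
  by compatibility of \<open>P\<close> with \<open>N\<close> that term then lies in \<open>N\<close>.\<close>

lemma class_projection:
  assumes N: "binsub N"
    and P_cst: "\<And>u c. u \<in> Homog \<Longrightarrow> c \<noteq> 0 \<Longrightarrow> P (cst c *s u) = P u"
    and P_mod: "\<And>u v. u \<in> Homog \<Longrightarrow> v \<in> Homog \<Longrightarrow> P u \<Longrightarrow> \<not> P v \<Longrightarrow> u + v \<in> N \<Longrightarrow> u \<in> N"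
  shows "\<exists>\<psi>. additive \<psi> \<and> (\<forall>m\<in>N. \<psi> m \<in> N) \<and> (\<forall>u\<in>Homog. \<psi> u = (if P u then u else 0))"
proof -
  \<comment> \<open>By \<open>P_cst\<close> the property \<open>P\<close> is constant on the nonzero
    elements of a line, so it becomes a set of degrees.\<close>
  define S where "S = {t \<in> T. \<exists>u\<in>D t. u \<noteq> 0 \<and> P u}"
  interpret proj: additive "proj S" by (rule additive_proj)
  note N_sub = binsub_subspace[OF N]
  have S_iff: "t \<in> S \<longleftrightarrow> P u" if t: "t \<in> T" and u: "u \<in> D t" "u \<noteq> 0" for t u
  proof
    assume "t \<in> S"
    then obtain v where v: "v \<in> D t" "v \<noteq> 0" "P v" unfolding S_def by blast
    obtain c where c: "v = cst c *s u" using D_line[OF t u v(1)] .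
    then have "c \<noteq> 0" using v by auto
    then show "P u" using P_cst[of u c] c v u t unfolding Homog_def by blast
  next
    assume "P u"
    then show "t \<in> S" unfolding S_def using t u by blast
  qed
  have Homog_cases: "u = 0 \<or> (\<exists>t\<in>T. u \<in> D t)" if "u \<in> Homog" for u
    using that unfolding Homog_def by blast
  have P: "proj S u = u" if "u \<in> Homog" "P u" for u
    using Homog_cases[OF that(1)]
  proof
    assume "\<exists>t\<in>T. u \<in> D t"
    then obtain t where "t \<in> T" "u \<in> D t" ..
    then show ?thesis using S_iff[of t u] that(2) by (cases "u = 0") (auto simp: proj_homogeneous)
  qed (simp add: proj.zero)
  have not_P: "proj S u = 0" if "u \<in> Homog" "\<not> P u" for u
    using Homog_cases[OF that(1)]
  proof
    assume "\<exists>t\<in>T. u \<in> D t"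
    then obtain t where "t \<in> T" "u \<in> D t" ..
    then show ?thesis using S_iff[of t u] that(2) by (cases "u = 0") (auto simp: proj_homogeneous)
  qed (simp add: proj.zero)
  have pair': "proj S (a + b) \<in> N" if "a \<in> Homog" "b \<in> Homog" "a + b \<in> N" "P a" for a b
  proof (cases "P b")
    case True
    then show ?thesis using that by (simp add: proj.add P)
  next
    case False
    then show ?thesis using that P_mod[of a b] by (simp add: proj.add P not_P)
  qed
  have pair: "proj S (a + b) \<in> N" if "a \<in> Homog" "b \<in> Homog" "a + b \<in> N" for a b
  proof (cases "P a")
    case True
    then show ?thesis using pair' that by blast
  next
    case False
    show ?thesis
    proof (cases "P b")
      case True
      then show ?thesis using pair'[of b a] that by (simp add: add.commute)
    next
      case b: False
      then show ?thesis using False that subspace_0[OF N_sub] by (simp add: proj.add not_P)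
    qed
  qed
  \<comment> \<open>\<open>proj S\<close> is not linear over the monoid algebra, so the claim is
    made for all multiples at once; this makes the set of good \<open>m\<close> a submodule.\<close>
  have "proj S (r *s m) \<in> N" if "m \<in> N" for r m
  proof -
    have "subspace {m. \<forall>r. proj S (r *s m) \<in> N}"
      by (rule subspaceI)
        (auto simp: proj.zero scale_right_distrib proj.add subspace_0[OF N_sub] subspace_add[OF N_sub])
    moreover have "N \<inter> Bin \<subseteq> {m. \<forall>r. proj S (r *s m) \<in> N}"
    proof safe
      fix b and r :: "'q \<Rightarrow>\<^sub>0 'k" assume b: "b \<in> N" "b \<in> Bin"
      then obtain u v where uv: "u \<in> Homog" "v \<in> Homog" "b = u + v" unfolding Bin_def by blast
      have "proj S (cst c *s x *s b) \<in> N" if "x \<in> monomials" for x c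
        using pair[of "cst c *s x *s u" "cst c *s x *s v"] uv b that
          subspace_scale[OF N_sub, of b "cst c * x"]
        by (auto simp: cst_Homog monomial_Homog scale_right_distrib simp del: scale_scale
            simp flip: scale_scale)
      then have "proj S (\<Sum>q\<in>Poly_Mapping.keys r.
          (cst (Poly_Mapping.lookup r q) * monoid_monomial q) *s b) \<in> N"
        unfolding proj.sum by (intro subspace_sum[OF N_sub]) (simp flip: scale_scale)
      then show "proj S (r *s b) \<in> N"
        using poly_mapping_expand[of r] by (metis scale_sum_left)
    qed
    ultimately have "span (N \<inter> Bin) \<subseteq> {m. \<forall>r. proj S (r *s m) \<in> N}" by (intro span_minimal)
    then show ?thesis using binsub_subset_span[OF N] that by blast
  qed
  from this[of _ 1] have "\<And>m. m \<in> N \<Longrightarrow> proj S m \<in> N" by simp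
  then show ?thesis using additive_proj P not_P by (intro exI[of _ "proj S"]) simp
qed

text \<open>This is the independence of distinct lines in \<open>M / N\<close>: the projection onto
  the elements outside \<open>N\<close> that are proportional to \<open>f i\<close> modulo
  \<open>N\<close> preserves \<open>N\<close>, fixes \<open>f i\<close> if it is not in
  \<open>N\<close>, and by \<open>isolated\<close> kills every other term.\<close>

lemma isolated_term_in:
  assumes N: "binsub N" and I: "finite I" "i \<in> I" "\<And>j. j \<in> I \<Longrightarrow> f j \<in> Homog" "(\<Sum>j\<in>I. f j) \<in> N"
    and isolated: "\<And>j c. j \<in> I \<Longrightarrow> j \<noteq> i \<Longrightarrow> f j - cst c *s f i \<in> N \<Longrightarrow> f j \<in> N"
  shows "f i \<in> N"
proof (rule ccontr)
  assume fi: "f i \<notin> N"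
  note N_sub = binsub_subspace[OF N]
  define P where "P u \<longleftrightarrow> u \<notin> N \<and> (\<exists>c. u - cst c *s f i \<in> N)" for u
  have P_cst: "P (cst c *s u)" if "P u" "c \<noteq> 0" for u c
  proof -
    obtain d where "u - cst d *s f i \<in> N" using \<open>P u\<close> unfolding P_def by blast
    then have "cst c *s (u - cst d *s f i) \<in> N" by (rule subspace_scale[OF N_sub])
    then have "cst c *s u - cst (c * d) *s f i \<in> N"
      by (simp add: scale_right_diff_distrib cst_mult)
    then show ?thesis
      using that unfolding P_def by (auto simp: cst_scale_in_iff[OF N_sub])
  qed
  have P_cst_eq: "P (cst c *s u) = P u" if "u \<in> Homog" "c \<noteq> 0" for u c
    using P_cst[of u c] P_cst[of "cst c *s u" "inverse c"] that(2) cst_scale_cancel[OF that(2)] by auto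
  have P_mod: "u \<in> N" if "u \<in> Homog" "v \<in> Homog" and Pu: "P u" and Pv: "\<not> P v" and uv: "u + v \<in> N" for u v
  proof (cases "v \<in> N")
    case True
    then show ?thesis using subspace_diff[OF N_sub uv] by force
  next
    case False
    obtain c where "u - cst c *s f i \<in> N" using Pu unfolding P_def by blast
    from subspace_diff[OF N_sub uv this] have "v - cst (- c) *s f i \<in> N"
      by (simp add: cst_minus add.commute)
    then show ?thesis using False Pv unfolding P_def by blast
  qed
  obtain \<psi> where \<psi>: "additive \<psi>" "\<And>m. m \<in> N \<Longrightarrow> \<psi> m \<in> N"
    "\<And>u. u \<in> Homog \<Longrightarrow> P u \<Longrightarrow> \<psi> u = u" "\<And>u. u \<in> Homog \<Longrightarrow> \<not> P u \<Longrightarrow> \<psi> u = 0"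
  proof -
    have "\<exists>\<psi>. additive \<psi> \<and> (\<forall>m\<in>N. \<psi> m \<in> N) \<and> (\<forall>u\<in>Homog. \<psi> u = (if P u then u else 0))"
      by (rule class_projection[OF N]) (fact P_cst_eq, fact P_mod)
    then show thesis using that by (elim exE conjE) simp
  qed
  interpret additive \<psi> by (rule \<psi>(1))
  have "f i - cst 1 *s f i \<in> N" using subspace_0[OF N_sub] by simp
  then have Pi: "P (f i)" unfolding P_def using fi by blast
  have "\<psi> (\<Sum>j\<in>I. f j) = (\<Sum>j\<in>I. if j = i then f i else 0)"
    unfolding sum
  proof (rule sum.cong[OF refl])
    fix j assume j: "j \<in> I"
    show "\<psi> (f j) = (if j = i then f i else 0)"
    proof (cases "j = i")
      case True
      then show ?thesis using Pi \<psi>(3) I by auto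
    next
      case False
      then have "\<not> P (f j)" using isolated[OF j False] unfolding P_def by blast
      then show ?thesis using False \<psi>(4) I(3)[OF j] by auto
    qed
  qed
  also have "\<dots> = f i" using I by simp
  finally show False using \<psi>(2)[OF I(4)] fi by simp
qed

section \<open>Colons and enlargements of binomial submodules\<close>

lemma reduced_Homog_representation:
  assumes "subspace Y"
  shows "\<exists>I r. finite I \<and> I \<subseteq> Homog \<and> m - (\<Sum>u\<in>I. cst (r u) *s u) \<in> Y \<and>
    (\<forall>u\<in>I. r u \<noteq> 0 \<and> u \<notin> Y) \<and> (\<forall>u\<in>I. \<forall>v\<in>I. u \<noteq> v \<longrightarrow> (\<forall>c. u - cst c *s v \<notin> Y))"
  using const.reduced_representation[OF const_span_Homog subspace_imp_const_subspace[OF assms]]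
  unfolding const_scale_eq .

lemma subspace_colon:
  assumes "subspace N"
  shows "subspace {m. r *s m \<in> N}"
proof (rule subspaceI)
  fix s m assume "m \<in> {m. r *s m \<in> N}"
  then have "s *s r *s m \<in> N" using subspace_scale[OF assms] by blast
  then show "s *s m \<in> {m. r *s m \<in> N}" by (simp add: mult.commute)
qed (auto simp: scale_right_distrib subspace_0[OF assms] subspace_add[OF assms])

text \<open>An element of the colon is reduced modulo the binomials of the colon. Multiplication by
  \<open>x\<close> makes no two remaining terms proportional modulo \<open>N\<close> unless they lie
  in \<open>N\<close>, since such a relation comes from a binomial of the colon. Each product is
  thus isolated and lies in \<open>N\<close>, so no terms remain.\<close>

lemma binsub_colon:
  assumes N: "binsub N" and x: "x \<in> monomials"
  shows "binsub {m. x *s m \<in> N}"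
proof (rule binsubI)
  note N_sub = binsub_subspace[OF N]
  define C where "C = {m. x *s m \<in> N}"
  show "subspace {m. x *s m \<in> N}" by (rule subspace_colon[OF N_sub])
  have C: "subspace C" unfolding C_def by (rule subspace_colon[OF N_sub])
  define Y where "Y = span (C \<inter> Bin)"
  have Y: "subspace Y" "Y \<subseteq> C" "\<And>m. m \<in> C \<Longrightarrow> m \<in> Bin \<Longrightarrow> m \<in> Y"
    unfolding Y_def using C by (auto intro: span_base span_minimal[THEN subsetD])
  have "m \<in> Y" if m: "m \<in> C" for m
  proof -
    obtain I r where I: "finite I" "I \<subseteq> Homog" "m - (\<Sum>u\<in>I. cst (r u) *s u) \<in> Y"
      "\<forall>u\<in>I. r u \<noteq> 0 \<and> u \<notin> Y" "\<forall>u\<in>I. \<forall>v\<in>I. u \<noteq> v \<longrightarrow> (\<forall>c. u - cst c *s v \<notin> Y)"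
      using reduced_Homog_representation[OF Y(1), of m] by (elim exE conjE)
    have r: "r u \<noteq> 0" if "u \<in> I" for u using I(4) that by blast
    have "I = {}"
    proof (rule ccontr)
      assume "I \<noteq> {}"
      then obtain u where u: "u \<in> I" by blast
      have "(\<Sum>v\<in>I. cst (r v) *s v) \<in> C"
        using subspace_diff[OF C m, of "m - (\<Sum>u\<in>I. cst (r u) *s u)"] I(3) Y(2) by auto
      then have sum_N: "(\<Sum>v\<in>I. cst (r v) *s x *s v) \<in> N"
        unfolding C_def by (simp add: scale_sum_right mult.commute)
      have "cst (r u) *s x *s u \<in> N"
      proof (rule isolated_term_in[OF N I(1) u _ sum_N])
        show "cst (r v) *s x *s v \<in> Homog" if "v \<in> I" for v
          using that I(2) x by (auto intro: cst_Homog monomial_Homog simp del: scale_scale)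
        show "cst (r v) *s x *s v \<in> N"
          if v: "v \<in> I" "v \<noteq> u" and in_N: "cst (r v) *s x *s v - cst c *s cst (r u) *s x *s u \<in> N" for v c
        proof -
          \<comment> \<open>The ratio for which \<open>v - cst d *s u\<close> is carried into
            \<open>N\<close> by \<open>x\<close>.\<close>
          define d where "d = inverse (r v) * (c * r u)"
          have "r v * d = c * r u"
            unfolding d_def using r[OF v(1)] by (simp add: field_simps)
          then have "cst (r v) * cst d = cst c * (cst (r u) :: 'q \<Rightarrow>\<^sub>0 'k)"
            by (simp flip: cst_mult)
          moreover have "cst (r v) *s x *s (v - cst d *s u)
              = cst (r v) *s x *s v - (cst (r v) * cst d) *s x *s u"
            by (simp add: scale_right_diff_distrib mult_ac)
          ultimately have "cst (r v) *s x *s (v - cst d *s u)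
              = cst (r v) *s x *s v - cst c *s cst (r u) *s x *s u"
            by (simp only: scale_scale mult.assoc)
          then have "x *s (v - cst d *s u) \<in> N"
            using in_N cst_scale_in_iff[OF N_sub r[OF v(1)]] by metis
          then have "v - cst d *s u \<in> C" unfolding C_def by simp
          then have "v - cst d *s u \<in> Y"
            using Y(3) Homog_diff_Bin I(2) u v(1) by blast
          then show ?thesis using I(5) u v by blast
        qed
      qed
      then have "u \<in> C"
        unfolding C_def using cst_scale_in_iff[OF N_sub r[OF u]] by blast
      then show False using Y(3) I(2,4) u Homog_subset_Bin by blast
    qed
    then show ?thesis using I(3) by simp
  qed
  then show "{m. x *s m \<in> N} \<subseteq> span ({m. x *s m \<in> N} \<inter> Bin)"
    unfolding C_def Y_def by blast
qed

lemma binsub_extend: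
  assumes "binsub N" "B \<subseteq> Bin"
  shows "binsub (span (N \<union> B))"
proof (rule binsubI)
  have "N \<subseteq> span (span (N \<union> B) \<inter> Bin)"
    using binsub_subset_span[OF assms(1)] span_mono[of "N \<inter> Bin" "span (N \<union> B) \<inter> Bin"]
      span_superset[of "N \<union> B"] by blast
  moreover have "B \<subseteq> span (span (N \<union> B) \<inter> Bin)"
    using assms(2) span_superset[of "N \<union> B"] span_superset[of "span (N \<union> B) \<inter> Bin"] by blast
  ultimately show "span (N \<union> B) \<subseteq> span (span (N \<union> B) \<inter> Bin)"
    by (intro span_minimal subspace_span) simp
qed (rule subspace_span)

text \<open>As \<open>Homog\<close> generates \<open>M\<close>, the span is \<open>N + r M\<close>.
  This presentation is chosen because its new generators are binomials when \<open>r\<close> is a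
  monomial or a form \<open>x - cst z * y\<close> in two monomials.\<close>

lemma span_image_Homog:
  assumes "subspace N" "m \<in> span (N \<union> (\<lambda>u. r *s u) ` Homog)"
  obtains w where "m - r *s w \<in> N"
proof -
  have "subspace {m. \<exists>w. m - r *s w \<in> N}"
  proof (rule subspaceI)
    show "0 \<in> {m. \<exists>w. m - r *s w \<in> N}"
      using subspace_0[OF assms(1)] by (auto intro!: exI[of _ 0])
  next
    fix a b assume "a \<in> {m. \<exists>w. m - r *s w \<in> N}" "b \<in> {m. \<exists>w. m - r *s w \<in> N}"
    then obtain v w where "a - r *s v \<in> N" "b - r *s w \<in> N" by blast
    from subspace_add[OF assms(1) this] have "(a + b) - r *s (v + w) \<in> N"
      by (simp add: algebra_simps)
    then show "a + b \<in> {m. \<exists>w. m - r *s w \<in> N}" by blast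
  next
    fix s a assume "a \<in> {m. \<exists>w. m - r *s w \<in> N}"
    then obtain v where "a - r *s v \<in> N" by blast
    from subspace_scale[OF assms(1) this, of s] have "s *s a - r *s s *s v \<in> N"
      by (simp add: algebra_simps)
    then show "s *s a \<in> {m. \<exists>w. m - r *s w \<in> N}" by blast
  qed
  moreover have "\<exists>w. m - r *s w \<in> N" if "m \<in> N" for m
    using that by (intro exI[of _ 0]) simp
  moreover have "\<exists>w. r *s u - r *s w \<in> N" for u
    using subspace_0[OF assms(1)] by (intro exI[of _ u]) simp
  ultimately have "span (N \<union> (\<lambda>u. r *s u) ` Homog) \<subseteq> {m. \<exists>w. m - r *s w \<in> N}"
    by (intro span_minimal) auto
  then show thesis using assms(2) that by blast
qed

lemma in_all_if_in_Homog:
  assumes "subspace N" "\<And>u. u \<in> Homog \<Longrightarrow> r *s u \<in> N"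
  shows "r *s m \<in> N"
proof -
  have "span Homog \<subseteq> {m. r *s m \<in> N}"
    using assms by (intro span_minimal subspace_colon) auto
  then show ?thesis using span_Homog by blast
qed

end

section \<open>Products of linear forms\<close>

text \<open>For \<open>degree p \<le> n\<close> this is \<open>y^n p(x/y)\<close>, written without
  division.\<close>

definition homogenization :: "('q::comm_monoid_add \<Rightarrow>\<^sub>0 'k::field) \<Rightarrow> ('q \<Rightarrow>\<^sub>0 'k) \<Rightarrow> nat \<Rightarrow> 'k poly \<Rightarrow> ('q \<Rightarrow>\<^sub>0 'k)" where
  "homogenization x y n p = (\<Sum>i\<le>n. cst (coeff p i) * (x ^ i * y ^ (n - i)))"

lemma homogenization_mult_linear:
  assumes "degree p \<le> n"
  shows "homogenization x y (Suc n) ([:- a, 1:] * p) = (x - cst a * y) * homogenization x y n p"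
proof -
  have "[:- a, 1:] * p = pCons 0 p - smult a p" by simp
  then have "homogenization x y (Suc n) ([:- a, 1:] * p)
      = homogenization x y (Suc n) (pCons 0 p) - homogenization x y (Suc n) (smult a p)"
    unfolding homogenization_def by (simp only: coeff_diff cst_diff left_diff_distrib sum_subtractf)
  also have "homogenization x y (Suc n) (pCons 0 p) = x * homogenization x y n p"
    unfolding homogenization_def sum.atMost_Suc_shift sum_distrib_left by (simp add: mult_ac)
  also have "homogenization x y (Suc n) (smult a p) = cst a * y * homogenization x y n p"
  proof -
    have "coeff p (Suc n) = 0" using assms by (simp add: coeff_eq_0)
    then have "homogenization x y (Suc n) (smult a p)
        = (\<Sum>i\<le>n. cst (a * coeff p i) * (x ^ i * y ^ (Suc n - i)))"
      unfolding homogenization_def by simp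
    also have "\<dots> = (\<Sum>i\<le>n. cst a * y * (cst (coeff p i) * (x ^ i * y ^ (n - i))))"
      by (intro sum.cong refl) (simp add: cst_mult Suc_diff_le mult_ac)
    finally show ?thesis unfolding homogenization_def sum_distrib_left .
  qed
  finally show ?thesis by (simp add: algebra_simps)
qed

lemma prod_linear_forms:
  "degree (\<Prod>a\<in>#A. [:- a, 1:]) = size A \<and>
   (\<Prod>a\<in>#A. x - cst a * y) = homogenization x y (size A) (\<Prod>a\<in>#A. [:- a, 1:])"
proof (induction A)
  case empty
  show ?case by (simp add: homogenization_def)
next
  case (add a A)
  have "(\<Prod>a\<in>#A. [:- a, 1:]) \<noteq> 0" by (auto simp: prod_mset_zero_iff)
  then have "degree ([:- a, 1:] * (\<Prod>a\<in>#A. [:- a, 1:])) = Suc (size A)"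
    using add by (subst degree_mult_eq) auto
  then show ?case
    using add homogenization_mult_linear[of "\<Prod>a\<in>#A. [:- a, 1:]" "size A" x y a] by simp
qed

text \<open>Under these hypotheses \<open>X^n - c\<close> is separable, so its roots form a set.
  Distinctness is what later makes the linear forms behave as coprime.\<close>

lemma prod_roots_of_constant:
  fixes c :: "'k::alg_closed_field"
  assumes n: "of_nat n \<noteq> (0 :: 'k)" and c: "c \<noteq> 0"
  obtains Z where "finite Z" "Z \<noteq> {}" "\<And>z. z \<in> Z \<Longrightarrow> z \<noteq> 0"
    "(\<Prod>z\<in>Z. x - cst z * y) = x ^ n - cst c * y ^ n"
proof -
  have n0: "n > 0" using n by (cases n) auto
  define p where "p = monom 1 n - [:c:]"
  have coeff_p: "coeff p i = (if i = n then 1 else 0) - (if i = 0 then c else 0)" for i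
    unfolding p_def by (auto simp: coeff_pCons split: nat.splits)
  have deg: "degree p = n"
    using n0 by (intro antisym degree_le le_degree) (auto simp: coeff_p)
  have lead: "lead_coeff p = 1" unfolding deg coeff_p using n0 by simp
  then have "p \<noteq> 0" by auto
  then obtain A where A: "size A = n" "p = (\<Prod>a\<in>#A. [:- a, 1:])"
    using alg_closed_imp_factorization[of p] lead deg by auto
  have poly_p: "poly p z = z ^ n - c" for z
    unfolding p_def by (simp add: poly_monom)
  have dp: "poly (pderiv p) z = of_nat n * z ^ (n - 1)" for z
    unfolding p_def by (simp add: pderiv_diff pderiv_monom poly_monom pderiv_pCons)
  have root: "poly p a = 0 \<and> a \<noteq> 0" if "a \<in># A" for a
  proof -
    have "poly p a = 0" using A(2) that by (auto simp: poly_prod_mset prod_mset_zero_iff)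
    moreover have "poly p 0 \<noteq> 0" using n0 c by (simp add: poly_p power_0_left)
    ultimately show ?thesis by metis
  qed
  \<comment> \<open>A double root would be a root of the derivative \<open>n X^(n-1)\<close>, hence
    0, which is not a root of \<open>p\<close>.\<close>
  have "count A a \<le> 1" for a
  proof (rule ccontr)
    assume "\<not> count A a \<le> 1"
    then have "{#a, a#} \<subseteq># A" by (simp add: subseteq_mset_def)
    then obtain B where "A = {#a, a#} + B" by (metis subset_mset.add_diff_inverse)
    then have "p = [:- a, 1:] * ([:- a, 1:] * (\<Prod>a\<in>#B. [:- a, 1:]))" and "a \<in># A"
      using A(2) by simp_all
    moreover have "poly (pderiv ([:- a, 1:] * ([:- a, 1:] * q))) a = 0" for q
      by (simp add: pderiv_mult del: mult_pCons_left)
    ultimately have "poly (pderiv p) a = 0" and "a \<in># A" by (simp_all only:)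
    then show False using dp[of a] n root[OF \<open>a \<in># A\<close>] by simp
  qed
  then have A_set: "A = mset_set (set_mset A)"
    by (intro multiset_eqI) (metis count_eq_zero_iff count_mset_set finite_set_mset
        le_neq_implies_less less_one)
  show thesis
  proof (rule that[of "set_mset A"])
    show "set_mset A \<noteq> {}" using A(1) n0 by auto
    show "z \<noteq> 0" if "z \<in> set_mset A" for z using root that by blast
    have "(\<Prod>z\<in>set_mset A. x - cst z * y) = (\<Prod>z\<in>#A. x - cst z * y)"
      using A_set by (metis prod_unfold_prod_mset)
    also have "\<dots> = homogenization x y n p"
      using prod_linear_forms[of A x y] A by simp
    also have "\<dots> = (\<Sum>i\<le>n. (if i = n then x ^ i * y ^ (n - i) else 0)
        - (if i = 0 then cst c * (x ^ i * y ^ (n - i)) else 0))"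
      unfolding homogenization_def coeff_p
      by (intro sum.cong) (auto simp: cst_diff cst_minus algebra_simps)
    also have "\<dots> = x ^ n - cst c * y ^ n"
      by (simp add: sum_subtractf)
    finally show "(\<Prod>z\<in>set_mset A. x - cst z * y) = x ^ n - cst c * y ^ n" .
  qed simp
qed

section \<open>Binomially irreducible submodules are primary\<close>

text \<open>\<open>irreducible\<close> speaks of finite families because the intersection of two
  binomial submodules need not be binomial, so larger families do not reduce to pairs. The splitting
  along \<open>n\<close>-th roots needs a member for each root.\<close>

locale binomially_irreducible = finely_graded_module scale act T D
  for scale :: "('q::comm_monoid_add \<Rightarrow>\<^sub>0 'k::alg_closed_field) \<Rightarrow> 'm::ab_group_add \<Rightarrow> 'm"
      (infixr \<open>*s\<close> 75)
    and act :: "'q \<Rightarrow> 't \<Rightarrow> 't" and T D +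
  fixes N :: "'m set"
  assumes N: "binsub N" and N_proper: "N \<noteq> UNIV"
    and irreducible: "\<And>\<C>. finite \<C> \<Longrightarrow> (\<And>P. P \<in> \<C> \<Longrightarrow> binsub P \<and> N \<subseteq> P) \<Longrightarrow> \<Inter>\<C> \<subseteq> N \<Longrightarrow> \<exists>P\<in>\<C>. P \<subseteq> N"
    and chain: "\<And>U. (\<And>n. subspace (U n)) \<Longrightarrow> incseq U \<Longrightarrow> \<exists>d. \<forall>n\<ge>d. U n = (U d :: 'm set)"
begin

lemmas N_subspace = binsub_subspace[OF N]

section \<open>Regular and nilpotent elements on the quotient\<close>

definition regular :: "('q \<Rightarrow>\<^sub>0 'k) \<Rightarrow> bool" where
  "regular r \<longleftrightarrow> (\<forall>m. r *s m \<in> N \<longrightarrow> m \<in> N)"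

definition nilpotent :: "('q \<Rightarrow>\<^sub>0 'k) \<Rightarrow> bool" where
  "nilpotent r \<longleftrightarrow> (\<exists>n. \<forall>m. r ^ n *s m \<in> N)"

lemma regularD: "regular r \<Longrightarrow> r *s m \<in> N \<Longrightarrow> m \<in> N"
  by (simp add: regular_def)

lemma regular_mult: "regular r \<Longrightarrow> regular s \<Longrightarrow> regular (r * s)"
  unfolding regular_def by (metis scale_scale)

lemma regular_1: "regular 1"
  by (simp add: regular_def)

lemma regular_power: "regular r \<Longrightarrow> regular (r ^ n)"
  by (induction n) (simp_all add: regular_1 regular_mult)

lemma nilpotent_0: "nilpotent 0"
  unfolding nilpotent_def by (intro exI[of _ 1]) (simp add: subspace_0[OF N_subspace])

lemma nilpotent_mult: "nilpotent r \<Longrightarrow> nilpotent (s * r)"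
  unfolding nilpotent_def
  by (metis power_mult_distrib scale_scale subspace_scale[OF N_subspace])

lemma nilpotent_power: "nilpotent (r ^ n) \<Longrightarrow> nilpotent r"
  unfolding nilpotent_def by (metis power_mult)

lemma nilpotent_add:
  assumes "nilpotent r" "nilpotent s"
  shows "nilpotent (r + s)"
proof -
  obtain i j where ij: "\<And>m. r ^ i *s m \<in> N" "\<And>m. s ^ j *s m \<in> N"
    using assms unfolding nilpotent_def by blast
  have "(r + s) ^ (i + j) *s m \<in> N" for m
  proof -
    have "(of_nat (i + j choose k) * r ^ k * s ^ (i + j - k)) *s m \<in> N" for k
    proof (cases "i \<le> k")
      case True
      then have "of_nat (i + j choose k) * r ^ k * s ^ (i + j - k)
          = r ^ i * (of_nat (i + j choose k) * r ^ (k - i) * s ^ (i + j - k))"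
        by (metis (no_types, lifting) le_add_diff_inverse mult.assoc mult.left_commute power_add)
      then show ?thesis by (metis ij(1) scale_scale)
    next
      case False
      then have "i + j - k = j + (i - k)" by simp
      then have "of_nat (i + j choose k) * r ^ k * s ^ (i + j - k)
          = s ^ j * (of_nat (i + j choose k) * r ^ k * s ^ (i - k))"
        by (simp add: power_add mult_ac)
      then show ?thesis by (metis ij(2) scale_scale)
    qed
    then show ?thesis
      unfolding binomial_ring scale_sum_left by (intro subspace_sum[OF N_subspace])
  qed
  then show ?thesis unfolding nilpotent_def by blast
qed

lemma ex_Homog_notin: obtains u where "u \<in> Homog" "u \<notin> N"
  using span_minimal[OF _ N_subspace, of Homog] span_Homog N_proper by blast

lemma monomial_regular_or_nilpotent:
  assumes x: "x \<in> monomials"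
  shows "regular x \<or> nilpotent x"
proof -
  define U where "U n = {m. x ^ n *s m \<in> N}" for n
  have "incseq U"
    unfolding U_def
    using subspace_scale[OF N_subspace] by (intro incseq_SucI) (auto simp flip: scale_scale)
  moreover have "subspace (U n)" for n
    unfolding U_def by (rule subspace_colon[OF N_subspace])
  ultimately obtain d where d: "\<And>n. n \<ge> d \<Longrightarrow> U n = U d"
    using chain by blast
  \<comment> \<open>The successor keeps the exponent positive: with \<open>n = 0\<close> the
    splitting would be trivial, as \<open>U 0 = N\<close>, and say nothing about
    \<open>x\<close>.\<close>
  define n where "n = Suc d"
  have Un: "U (n + n) = U n" using d[of "n + n"] d[of n] by (simp add: n_def)
  define P where "P = span (N \<union> (\<lambda>u. x ^ n *s u) ` Homog)"
  have xn: "x ^ n \<in> monomials" by (rule power_in_monomials[OF x])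
  have "\<exists>P'\<in>{U n, P}. P' \<subseteq> N"
  proof (rule irreducible)
    fix P' assume "P' \<in> {U n, P}"
    moreover have "binsub (U n)" unfolding U_def by (rule binsub_colon[OF N xn])
    moreover have "N \<subseteq> U n" unfolding U_def using subspace_scale[OF N_subspace] by blast
    moreover have "binsub P"
      unfolding P_def using monomial_Homog[OF xn] Homog_subset_Bin by (intro binsub_extend[OF N]) auto
    moreover have "N \<subseteq> P" unfolding P_def using span_superset by blast
    ultimately show "binsub P' \<and> N \<subseteq> P'" by blast
  next
    \<comment> \<open>If \<open>m\<close> is \<open>x^n w\<close> modulo \<open>N\<close> and
      \<open>x^n m\<close> lies in \<open>N\<close>, then so does \<open>x^(2n) w\<close>, and
      stationarity already puts \<open>x^n w\<close> into \<open>N\<close>.\<close>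
    have "m \<in> N" if "m \<in> U n" "m \<in> P" for m
    proof -
      obtain w where w: "m - x ^ n *s w \<in> N"
        using span_image_Homog[OF N_subspace] \<open>m \<in> P\<close> unfolding P_def by blast
      have "x ^ n *s m \<in> N" using \<open>m \<in> U n\<close> unfolding U_def by simp
      from subspace_diff[OF N_subspace this subspace_scale[OF N_subspace w]]
      have "x ^ n *s m - x ^ n *s (m - x ^ n *s w) \<in> N" .
      then have "w \<in> U (n + n)"
        unfolding U_def by (simp add: scale_right_diff_distrib power_add)
      then have "x ^ n *s w \<in> N" using Un unfolding U_def by blast
      from subspace_add[OF N_subspace w this] show ?thesis by simp
    qed
    then show "\<Inter>{U n, P} \<subseteq> N" by blast
  qed simp
  then show ?thesis
  proof (elim bexE insertE emptyE; hypsubst)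
    assume "U n \<subseteq> N"
    have "m \<in> N" if "x *s m \<in> N" for m
    proof -
      have "x ^ d *s x *s m \<in> N" using that by (rule subspace_scale[OF N_subspace])
      then have "m \<in> U n" unfolding U_def n_def by (simp add: mult.commute)
      then show ?thesis using \<open>U n \<subseteq> N\<close> by blast
    qed
    then have "regular x" by (simp add: regular_def)
    then show ?thesis ..
  next
    assume "P \<subseteq> N"
    then have "x ^ n *s u \<in> N" if "u \<in> Homog" for u
      using span_superset[of "N \<union> (\<lambda>u. x ^ n *s u) ` Homog"] that unfolding P_def by blast
    then have "x ^ n *s m \<in> N" for m
      by (rule in_all_if_in_Homog[OF N_subspace])
    then have "nilpotent x" unfolding nilpotent_def by blast
    then show ?thesis ..
  qed
qed

text \<open>Two of the forms differ by a nonzero constant times the regular element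
  \<open>y\<close>. In the induction, \<open>t *s v\<close> is killed by two such forms, hence by
  their difference, and so lies in \<open>N\<close>.\<close>

lemma coprime_linear_forms:
  assumes y: "regular y" and "finite Z" "Z \<noteq> {}"
    and "\<And>z. z \<in> Z \<Longrightarrow> (\<Prod>z'\<in>Z - {z}. x - cst z' * y) *s v \<in> N"
  shows "v \<in> N"
  using assms(2-)
proof (induction Z rule: finite_ne_induct)
  case (singleton z)
  then show ?case by simp
next
  case (insert a Z)
  show ?case
  proof (rule insert.IH)
    fix z assume z: "z \<in> Z"
    define t where "t = (\<Prod>z'\<in>Z - {z}. x - cst z' * y)"
    have "a \<noteq> z" using insert z by blast
    then have "insert a Z - {z} = insert a (Z - {z})" by blast
    then have "(\<Prod>z'\<in>insert a Z - {z}. x - cst z' * y) = (x - cst a * y) * t"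
      using insert.hyps by (simp add: t_def)
    then have 1: "((x - cst a * y) * t) *s v \<in> N" using insert.prems[of z] z by simp
    have "(\<Prod>z'\<in>insert a Z - {a}. x - cst z' * y) = (\<Prod>z'\<in>Z. x - cst z' * y)"
      using insert.hyps by simp
    also have "\<dots> = (x - cst z * y) * t"
      unfolding t_def by (rule prod.remove[OF insert.hyps(1) z])
    finally have eq: "(\<Prod>z'\<in>insert a Z - {a}. x - cst z' * y) = (x - cst z * y) * t" .
    have 2: "((x - cst z * y) * t) *s v \<in> N" using insert.prems[of a, unfolded eq] by blast
    have "(x - cst z * y) * t - (x - cst a * y) * t = cst (a - z) * (y * t)"
      by (simp add: cst_diff left_diff_distrib mult.assoc)
    then have "((x - cst z * y) * t) *s v - ((x - cst a * y) * t) *s v = cst (a - z) *s y *s t *s v"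
      by (simp only: scale_left_diff_distrib[symmetric] scale_scale)
    then have "cst (a - z) *s y *s t *s v \<in> N"
      using subspace_diff[OF N_subspace 2 1] by (simp only:)
    then have "y *s t *s v \<in> N"
      using \<open>a \<noteq> z\<close> cst_scale_in_iff[OF N_subspace, of "a - z"] by (simp del: scale_scale)
    then show "t *s v \<in> N" by (rule regularD[OF y])
  qed
qed

lemma Homog_sum: "\<exists>(I :: 'm set) f. finite I \<and> (\<forall>u\<in>I. f u \<in> Homog) \<and> w = (\<Sum>u\<in>I. f u)"
proof -
  obtain I r where "finite I" "I \<subseteq> Homog" "w - (\<Sum>u\<in>I. cst (r u) *s u) \<in> {0}"
    using reduced_Homog_representation[OF subspace_single_0, of w] by (elim exE conjE)
  then show ?thesis
    using cst_Homog by (intro exI[of _ I] exI[of _ "\<lambda>u. cst (r u) *s u"]) auto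
qed

text \<open>If \<open>x\<^sup>n - c y\<^sup>n\<close> kills the monomial \<open>u \<notin> N\<close> and \<open>n \<noteq> 0\<close> in the field, then \<open>N\<close> is the
  intersection of the submodule generated by all monomials killed by \<open>x\<^sup>n - c y\<^sup>n\<close> with the
  submodules \<open>N + (x - z y) M\<close>, where \<open>z\<close> runs over the distinct \<open>n\<close>-th roots of \<open>c\<close>.\<close>

lemma linear_form_annihilates:
  assumes x: "x \<in> monomials" "regular x" and y: "y \<in> monomials" "regular y"
    and u: "u \<in> Homog" "u \<notin> N" and K: "(x ^ n - cst c * y ^ n) *s u \<in> N"
    and n: "of_nat n \<noteq> (0 :: 'k)"
  shows "\<exists>z. \<forall>m. (x - cst z * y) *s m \<in> N"
proof -
  have "c \<noteq> 0"
  proof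
    assume "c = 0"
    then have "x ^ n *s u \<in> N" using K by simp
    then show False using regularD[OF regular_power[OF x(2)]] u by blast
  qed
  then obtain Z where Z: "finite Z" "Z \<noteq> {}" "\<And>z. z \<in> Z \<Longrightarrow> z \<noteq> 0"
    "(\<Prod>z\<in>Z. x - cst z * y) = x ^ n - cst c * y ^ n"
    using prod_roots_of_constant[OF n, where x = x and y = y] by metis
  define L where "L = x ^ n - cst c * y ^ n"
  define b where "b z = x - cst z * y" for z
  define E where "E = span (N \<union> {w \<in> Homog. L *s w \<in> N})"
  define P where "P z = span (N \<union> (\<lambda>w. b z *s w) ` Homog)" for z
  have L_mult: "L *s r *s w \<in> N" if "L *s w \<in> N" for r w
    using subspace_scale[OF N_subspace that, of r] by (simp add: mult.commute)
  have cst_iff: "(L *s cst d *s w \<in> N) = (L *s w \<in> N)" if "w \<in> Homog" "d \<noteq> 0" for w d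
    using cst_scale_in_iff[OF N_subspace that(2), of "L *s w"] by (simp add: mult.commute)
  have mod: "v \<in> N" if "v \<in> Homog" "w \<in> Homog" "L *s v \<in> N" "\<not> L *s w \<in> N" "v + w \<in> N" for v w
    using that subspace_diff[OF N_subspace subspace_scale[OF N_subspace that(5), of L] that(3)]
    by (simp add: scale_right_distrib)
  have "\<exists>\<psi>. additive \<psi> \<and> (\<forall>m\<in>N. \<psi> m \<in> N) \<and> (\<forall>w\<in>Homog. \<psi> w = (if L *s w \<in> N then w else 0))"
    by (rule class_projection[OF N]) (fact cst_iff, fact mod)
  then obtain \<psi> where \<psi>: "additive \<psi>" "\<And>m. m \<in> N \<Longrightarrow> \<psi> m \<in> N"
    "\<And>w. w \<in> Homog \<Longrightarrow> \<psi> w = (if L *s w \<in> N then w else 0)"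
    by (elim exE conjE) simp
  interpret \<psi>: additive \<psi> by (rule \<psi>(1))
  have \<psi>_E: "v - \<psi> v \<in> N" if "v \<in> E" for v
  proof -
    \<comment> \<open>The condition ranges over all multiples because \<open>\<psi>\<close> is only
      additive; this makes \<open>W\<close> a submodule.\<close>
    define W where "W = {v. \<forall>r. r *s v - \<psi> (r *s v) \<in> N}"
    have "subspace W"
    proof (rule subspaceI)
      show "0 \<in> W" unfolding W_def using subspace_0[OF N_subspace] by (simp add: \<psi>.zero)
      fix v w assume vw: "v \<in> W" "w \<in> W"
      have "r *s (v + w) - \<psi> (r *s (v + w)) \<in> N" for r
      proof -
        have "(r *s v - \<psi> (r *s v)) + (r *s w - \<psi> (r *s w)) \<in> N"
          using vw unfolding W_def by (intro subspace_add[OF N_subspace]) auto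
        then show ?thesis by (simp add: scale_right_distrib \<psi>.add algebra_simps)
      qed
      then show "v + w \<in> W" unfolding W_def by blast
    next
      fix s v assume "v \<in> W"
      then show "s *s v \<in> W" unfolding W_def by simp
    qed
    moreover have "N \<subseteq> W"
      unfolding W_def
      using subspace_diff[OF N_subspace] subspace_scale[OF N_subspace] \<psi>(2) by blast
    moreover have "w \<in> W" if w: "w \<in> Homog" "L *s w \<in> N" for w
    proof -
      have "\<psi> (r *s w) = r *s w" for r
      proof -
        have "\<psi> (cst d *s p *s w) = cst d *s p *s w" if "p \<in> monomials" for d p
          using L_mult[OF w(2), of "cst d * p"] cst_Homog[OF monomial_Homog[OF that w(1)]] \<psi>(3)
          by simp
        then have "\<psi> (\<Sum>q\<in>Poly_Mapping.keys r. cst (Poly_Mapping.lookup r q) *s monoid_monomial q *s w)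
          = (\<Sum>q\<in>Poly_Mapping.keys r. cst (Poly_Mapping.lookup r q) *s monoid_monomial q *s w)"
          unfolding \<psi>.sum by (intro sum.cong) auto
        moreover have "(\<Sum>q\<in>Poly_Mapping.keys r. cst (Poly_Mapping.lookup r q) *s monoid_monomial q *s w) = r *s w"
          unfolding scale_scale scale_sum_left[symmetric] using poly_mapping_expand[of r] by simp
        ultimately show ?thesis by simp
      qed
      then show ?thesis unfolding W_def by (simp add: subspace_0[OF N_subspace])
    qed
    ultimately have "E \<subseteq> W" unfolding E_def by (intro span_minimal) auto
    then have "1 *s v - \<psi> (1 *s v) \<in> N" using that unfolding W_def by blast
    then show ?thesis by simp
  qed
  have L_\<psi>: "L *s \<psi> w \<in> N" for w
  proof -
    obtain I :: "'m set" and f where I: "finite I" "\<forall>u\<in>I. f u \<in> Homog" "w = (\<Sum>u\<in>I. f u)"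
      using Homog_sum[of w] by (elim exE conjE)
    then show ?thesis
      unfolding I(3) \<psi>.sum scale_sum_right using I(2)
      by (intro subspace_sum[OF N_subspace]) (auto simp: \<psi>(3) subspace_0[OF N_subspace])
  qed
  \<comment> \<open>Multiplying by the regular monomial \<open>x\<close> or \<open>y\<close> does
    not change whether \<open>L\<close> kills a homogeneous element, so \<open>\<psi>\<close>
    commutes with both terms of \<open>b z\<close>. The second term also needs
    \<open>z \<noteq> 0\<close>.\<close>
  have \<psi>_b: "\<psi> (b z *s w) = b z *s \<psi> w" if z: "z \<in> Z" for z w
  proof -
    have shift: "L *s p *s v \<in> N \<longleftrightarrow> L *s v \<in> N" if "regular p" for p v
      using L_mult[of v p] regularD[OF that, of "L *s v"] by (auto simp: mult.commute)
    have Homog: "\<psi> (b z *s v) = b z *s \<psi> v" if v: "v \<in> Homog" for v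
    proof -
      have bz: "b z *s m = x *s m + cst (- z) *s y *s m" for m
        by (simp add: b_def scale_left_diff_distrib cst_minus)
      have "\<psi> (x *s v) = x *s \<psi> v"
        using \<psi>(3) monomial_Homog[OF x(1) v] shift[OF x(2)] v by simp
      moreover have "\<psi> (cst (- z) *s y *s v) = cst (- z) *s y *s \<psi> v"
        using \<psi>(3)[OF cst_Homog[OF monomial_Homog[OF y(1) v], of "- z"]] \<psi>(3)[OF v]
          cst_iff[OF monomial_Homog[OF y(1) v], of "- z"] shift[OF y(2)] Z(3)[OF z]
        by (simp del: scale_scale)
      ultimately show ?thesis unfolding bz \<psi>.add by (simp only:)
    qed
    obtain I :: "'m set" and f where I: "finite I" "\<forall>u\<in>I. f u \<in> Homog" "w = (\<Sum>u\<in>I. f u)"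
      using Homog_sum[of w] by (elim exE conjE)
    then show ?thesis
      unfolding I(3) \<psi>.sum scale_sum_right using I(2) by (intro sum.cong refl Homog) blast
  qed
  have "\<exists>P'\<in>insert E (P ` Z). P' \<subseteq> N"
  proof (rule irreducible)
    fix P' assume "P' \<in> insert E (P ` Z)"
    moreover have "binsub E"
      unfolding E_def using Homog_subset_Bin by (intro binsub_extend[OF N]) blast
    moreover have "N \<subseteq> E" "\<And>z. N \<subseteq> P z" unfolding E_def P_def using span_superset by blast+
    moreover have "binsub (P z)" for z
    proof -
      have "b z *s w \<in> Bin" if "w \<in> Homog" for w
        using Homog_diff_Bin[OF monomial_Homog[OF x(1) that] monomial_Homog[OF y(1) that], of z]
        by (simp add: b_def scale_left_diff_distrib)
      then show ?thesis unfolding P_def by (intro binsub_extend[OF N]) blast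
    qed
    ultimately show "binsub P' \<and> N \<subseteq> P'" by blast
  next
    \<comment> \<open>Modulo \<open>N\<close>, \<open>v\<close> equals \<open>\<psi> v\<close> and
      then \<open>b z *s \<psi> w\<close>. The product of the other forms turns this into
      \<open>L *s \<psi> w\<close>, which lies in \<open>N\<close>.\<close>
    have "v \<in> N" if v: "v \<in> E" "\<And>z. z \<in> Z \<Longrightarrow> v \<in> P z" for v
    proof (rule coprime_linear_forms[OF y(2) Z(1,2), of x])
      fix z assume z: "z \<in> Z"
      define t where "t = (\<Prod>z'\<in>Z - {z}. x - cst z' * y)"
      obtain w where "v - b z *s w \<in> N"
        using span_image_Homog[OF N_subspace] v(2)[OF z] unfolding P_def by blast
      then have "\<psi> v - b z *s \<psi> w \<in> N"
        using \<psi>(2)[of "v - b z *s w"] by (simp add: \<psi>.diff \<psi>_b[OF z])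
      from subspace_add[OF N_subspace \<psi>_E[OF v(1)] this] have "v - b z *s \<psi> w \<in> N" by simp
      then have "t *s (v - b z *s \<psi> w) \<in> N" by (rule subspace_scale[OF N_subspace])
      moreover have "b z * t = L"
        unfolding L_def Z(4)[symmetric] b_def t_def by (rule prod.remove[OF Z(1) z, symmetric])
      ultimately have "t *s v - L *s \<psi> w \<in> N"
        by (simp add: scale_right_diff_distrib mult.commute)
      from subspace_add[OF N_subspace this L_\<psi>[of w]] show "t *s v \<in> N" by simp
    qed
    then show "\<Inter>(insert E (P ` Z)) \<subseteq> N" by auto
  qed (use Z in simp)
  then consider "E \<subseteq> N" | z where "z \<in> Z" "P z \<subseteq> N" by blast
  then show ?thesis
  proof cases
    case 1
    have "u \<in> E" unfolding E_def using u(1) K by (intro span_base) (simp add: L_def)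
    then show ?thesis using 1 u by blast
  next
    case 2
    have "b z *s w \<in> N" if "w \<in> Homog" for w
      using 2(2) span_superset[of "N \<union> (\<lambda>w. b z *s w) ` Homog"] that unfolding P_def by blast
    then have "b z *s m \<in> N" for m
      by (rule in_all_if_in_Homog[OF N_subspace])
    then show ?thesis unfolding b_def by blast
  qed
qed

text \<open>In characteristic \<open>p\<close>, factors \<open>p\<close> of the exponent are moved into \<open>x\<close> and \<open>y\<close>, and undone
  by Frobenius at the cost of nilpotency.\<close>

lemma linear_form_nilpotent:
  assumes "x \<in> monomials" "regular x" "y \<in> monomials" "regular y"
    and u: "u \<in> Homog" "u \<notin> N" and "(x ^ n - cst c * y ^ n) *s u \<in> N" "n > 0"
  shows "(\<exists>j>0. \<exists>z. \<forall>m. (x ^ j - cst z * y ^ j) *s m \<in> N) \<and> (\<exists>z. nilpotent (x - cst z * y))"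
  using assms(1-4,7,8)
proof (induction n arbitrary: x y rule: less_induct)
  case (less n)
  show ?case
  proof (cases "of_nat n = (0 :: 'k)")
    case False
    then obtain z where z: "\<And>m. (x - cst z * y) *s m \<in> N"
      using linear_form_annihilates[OF less.prems(1-4) u less.prems(5)] by blast
    then have "nilpotent (x - cst z * y)"
      unfolding nilpotent_def by (intro exI[of _ 1]) simp
    moreover have "\<exists>j>0. \<exists>z. \<forall>m. (x ^ j - cst z * y ^ j) *s m \<in> N"
      using z by (intro exI[of _ 1] conjI exI[of _ z]) simp_all
    ultimately show ?thesis by blast
  next
    case True
    define p where "p = CHAR('k)"
    have pn: "p dvd n" using True by (simp add: p_def of_nat_eq_0_iff_char_dvd)
    then have "p > 0" using less.prems(6) by (auto intro: Nat.gr0I)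
    then have p: "prime p" unfolding p_def by (rule prime_CHAR_semidom)
    have char: "CHAR('q \<Rightarrow>\<^sub>0 'k) = p"
    proof (rule CHAR_eqI)
      show "of_nat p = (0 :: 'q \<Rightarrow>\<^sub>0 'k)"
        unfolding cst_of_nat[symmetric] p_def by simp
      show "p dvd i" if "of_nat i = (0 :: 'q \<Rightarrow>\<^sub>0 'k)" for i
      proof -
        have "Poly_Mapping.single (0 :: 'q) (of_nat i :: 'k) = 0"
          using that unfolding cst_of_nat[symmetric] cst_def .
        then have "of_nat i = (0 :: 'k)" by (metis lookup_single_eq lookup_zero)
        then show ?thesis by (simp add: p_def of_nat_eq_0_iff_char_dvd)
      qed
    qed
    obtain k where k: "n = p * k" using pn by blast
    have "k > 0" using less.prems(6) k by (auto intro: Nat.gr0I)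
    moreover have "k < n" using k \<open>k > 0\<close> prime_gt_1_nat[OF p] by simp
    moreover have "((x ^ p) ^ k - cst c * (y ^ p) ^ k) *s u \<in> N"
      using less.prems(5) unfolding k by (simp only: power_mult)
    ultimately have IH: "\<exists>j>0. \<exists>z. \<forall>m. ((x ^ p) ^ j - cst z * (y ^ p) ^ j) *s m \<in> N"
        "\<exists>z. nilpotent (x ^ p - cst z * y ^ p)"
      using less.IH[of k "x ^ p" "y ^ p"] less.prems(1-4)
      by (simp_all add: power_in_monomials regular_power)
    from IH(1) obtain j z where j: "j > 0" "\<And>m. ((x ^ p) ^ j - cst z * (y ^ p) ^ j) *s m \<in> N"
      by blast
    then have powers: "\<exists>j>0. \<exists>z. \<forall>m. (x ^ j - cst z * y ^ j) *s m \<in> N"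
      using \<open>p > 0\<close> by (intro exI[of _ "p * j"] conjI exI[of _ z]) (simp_all add: power_mult)
    obtain d where d: "nilpotent (x ^ p - cst d * y ^ p)" using IH(2) by blast
    \<comment> \<open>With the sign under the root, Frobenius for the sum \<open>x + e y\<close>
      gives \<open>x^p - d y^p\<close> without distinguishing characteristic 2.\<close>
    obtain e where e: "e ^ p = - d" using nth_root_exists[OF \<open>p > 0\<close>] by blast
    have "(x - cst (- e) * y) ^ p = (x + cst e * y) ^ p"
      by (simp add: cst_minus)
    also have "\<dots> = x ^ p + (cst e * y) ^ p"
      using p by (intro freshmans_dream) (simp_all add: char)
    also have "\<dots> = x ^ p - cst d * y ^ p"
      by (simp add: power_mult_distrib cst_power[symmetric] e cst_minus)
    finally have "nilpotent (x - cst (- e) * y)"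
      using d nilpotent_power[of "x - cst (- e) * y" p] by simp
    then show ?thesis using powers by blast
  qed
qed

section \<open>Commensurability of regular monomials\<close>

definition F :: "('q \<Rightarrow>\<^sub>0 'k) set" where
  "F = {x \<in> monomials. regular x}"

text \<open>One line outside \<open>N\<close> suffices, so that incommensurability excludes a
  relation on every line. For elements of \<open>F\<close>, \<open>commensurable_annihilates\<close>
  recovers a relation on all of \<open>M\<close>.\<close>

definition commensurable :: "('q \<Rightarrow>\<^sub>0 'k) \<Rightarrow> ('q \<Rightarrow>\<^sub>0 'k) \<Rightarrow> bool" where
  "commensurable x y \<longleftrightarrow> (\<exists>u\<in>Homog - N. \<exists>n>0. \<exists>c. (x ^ n - cst c * y ^ n) *s u \<in> N)"

lemma F_mult: "x \<in> F \<Longrightarrow> y \<in> F \<Longrightarrow> x * y \<in> F"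
  and F_power: "x \<in> F \<Longrightarrow> x ^ n \<in> F"
  and F_one: "1 \<in> F"
  unfolding F_def
  by (simp_all add: mult_in_monomials power_in_monomials one_in_monomials regular_mult regular_power
      regular_1)

text \<open>Irreducibility passes from one line to all of \<open>M\<close>. The first conclusion is
  exact, with \<open>j\<close> absorbing powers of the characteristic, and can be multiplied; the
  second merges commensurable monomials up to nilpotent elements.\<close>

lemma
  assumes "x \<in> F" "y \<in> F" "commensurable x y"
  shows commensurable_annihilates: "\<exists>j>0. \<exists>z. \<forall>m. (x ^ j - cst z * y ^ j) *s m \<in> N"
    and commensurable_nilpotent: "\<exists>z. nilpotent (x - cst z * y)"
proof -
  obtain u n c where "u \<in> Homog" "u \<notin> N" "n > 0" "(x ^ n - cst c * y ^ n) *s u \<in> N"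
    using assms(3) unfolding commensurable_def by blast
  moreover have "x \<in> monomials" "regular x" "y \<in> monomials" "regular y"
    using assms(1,2) by (simp_all add: F_def)
  ultimately have "(\<exists>j>0. \<exists>z. \<forall>m. (x ^ j - cst z * y ^ j) *s m \<in> N) \<and> (\<exists>z. nilpotent (x - cst z * y))"
    by (intro linear_form_nilpotent)
  then show "\<exists>j>0. \<exists>z. \<forall>m. (x ^ j - cst z * y ^ j) *s m \<in> N" "\<exists>z. nilpotent (x - cst z * y)"
    by blast+
qed

lemma commensurableI:
  assumes "j > 0" "\<And>m. (x ^ j - cst z * y ^ j) *s m \<in> N"
  shows "commensurable x y"
proof -
  obtain u where "u \<in> Homog" "u \<notin> N" by (rule ex_Homog_notin)
  then show ?thesis
    unfolding commensurable_def using assms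
    by (intro bexI[of _ u] exI[of _ j] conjI exI[of _ z]) simp_all
qed

lemma commensurable_refl: "commensurable x x"
  by (rule commensurableI[of 1 _ 1]) (simp_all add: subspace_0[OF N_subspace])

lemma commensurable_sym:
  assumes x: "x \<in> F" and xy: "commensurable x y"
  shows "commensurable y x"
proof -
  obtain u n c where u: "u \<in> Homog" "u \<notin> N" and n: "n > 0" and c: "(x ^ n - cst c * y ^ n) *s u \<in> N"
    using xy unfolding commensurable_def by blast
  have reg: "regular (x ^ n)" using F_power[OF x] by (simp add: F_def)
  have "c \<noteq> 0"
  proof
    assume "c = 0"
    then have "x ^ n *s u \<in> N" using c by simp
    then show False using regularD[OF reg] u by blast
  qed
  have "cst (- inverse c) * (x ^ n - cst c * y ^ n) = y ^ n - cst (inverse c) * x ^ n"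
    using \<open>c \<noteq> 0\<close>
    by (simp add: cst_minus right_diff_distrib mult.assoc[symmetric]) (simp flip: cst_mult)
  then have "(y ^ n - cst (inverse c) * x ^ n) *s u \<in> N"
    using subspace_scale[OF N_subspace c, of "cst (- inverse c)"] by simp
  then show ?thesis using u n unfolding commensurable_def by blast
qed

lemma commensurable_power: "commensurable (x ^ n) (y ^ n) \<Longrightarrow> n > 0 \<Longrightarrow> commensurable x y"
  unfolding commensurable_def power_mult[symmetric] by (meson nat_0_less_mult_iff)

lemma annihilates_power:
  assumes "\<And>m. (x - cst z * y) *s m \<in> N"
  shows "(x ^ n - cst (z ^ n) * y ^ n) *s m \<in> N"
proof -
  have "x ^ n - (cst z * y) ^ n = (x - cst z * y) * (\<Sum>i<n. (cst z * y) ^ (n - Suc i) * x ^ i)"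
    by (rule power_diff_sumr2)
  then show ?thesis
    using assms by (simp add: power_mult_distrib cst_power flip: scale_scale)
qed

text \<open>Both relations are brought to the exponent \<open>i * j\<close> and combined by
  \<open>X X' - a b = (X - a) X' + (X' - b) a\<close>. They get applied to multiples of
  \<open>m\<close>, so they must hold on all of \<open>M\<close>.\<close>

lemma commensurable_mult:
  assumes F: "x \<in> F" "y \<in> F" "x' \<in> F" "y' \<in> F"
    and "commensurable x y" "commensurable x' y'"
  shows "commensurable (x * x') (y * y')"
proof -
  obtain i z where i: "i > 0" "\<And>m. (x ^ i - cst z * y ^ i) *s m \<in> N"
    using commensurable_annihilates[OF F(1,2) assms(5)] by blast
  obtain j z' where j: "j > 0" "\<And>m. (x' ^ j - cst z' * y' ^ j) *s m \<in> N"
    using commensurable_annihilates[OF F(3,4) assms(6)] by blast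
  define a b where "a = cst (z ^ j) * (y ^ i) ^ j" and "b = cst (z' ^ i) * (y' ^ j) ^ i"
  have 1: "((x ^ i) ^ j - a) *s m \<in> N" for m
    unfolding a_def by (rule annihilates_power) (rule i(2))
  have 2: "((x' ^ j) ^ i - b) *s m \<in> N" for m
    unfolding b_def by (rule annihilates_power) (rule j(2))
  show ?thesis
  proof (rule commensurableI)
    show "i * j > 0" using i j by simp
    fix m
    have "(x * x') ^ (i * j) = (x ^ i) ^ j * (x' ^ j) ^ i"
      by (simp add: power_mult_distrib power_mult[symmetric] mult.commute)
    moreover have "cst (z ^ j * z' ^ i) * (y * y') ^ (i * j) = a * b"
      by (simp add: a_def b_def cst_mult power_mult_distrib power_mult[symmetric] mult_ac)
    ultimately have "(x * x') ^ (i * j) - cst (z ^ j * z' ^ i) * (y * y') ^ (i * j)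
        = ((x ^ i) ^ j - a) * (x' ^ j) ^ i + ((x' ^ j) ^ i - b) * a"
      by (simp add: algebra_simps)
    then show "((x * x') ^ (i * j) - cst (z ^ j * z' ^ i) * (y * y') ^ (i * j)) *s m \<in> N"
      using subspace_add[OF N_subspace 1[of "(x' ^ j) ^ i *s m"] 2[of "a *s m"]]
      by (simp add: scale_left_distrib)
  qed
qed

lemma commensurable_cancel:
  assumes z: "z \<in> F" and "commensurable (x * z) (y * z)"
  shows "commensurable x y"
proof -
  obtain u n c where u: "u \<in> Homog - N" and n: "n > 0"
    and c: "((x * z) ^ n - cst c * (y * z) ^ n) *s u \<in> N"
    using assms(2) unfolding commensurable_def by blast
  have "(x * z) ^ n - cst c * (y * z) ^ n = z ^ n * (x ^ n - cst c * y ^ n)"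
    by (simp add: power_mult_distrib algebra_simps)
  then have "z ^ n *s (x ^ n - cst c * y ^ n) *s u \<in> N" using c by (simp only: scale_scale)
  moreover have "regular (z ^ n)" using F_power[OF z] by (simp add: F_def)
  ultimately have "(x ^ n - cst c * y ^ n) *s u \<in> N" using regularD by blast
  then show ?thesis using u n unfolding commensurable_def by blast
qed

text \<open>A pair \<open>(a, b)\<close> reads as \<open>a > b\<close>, or as a positive fraction
  \<open>a / b\<close>: a strict positive cone in the group of fractions of \<open>F\<close> modulo
  commensurability, with no quotient formed. Transitivity and cancellation of common factors inside
  \<open>C\<close> are not built in.\<close>

definition cone :: "(('q \<Rightarrow>\<^sub>0 'k) \<times> ('q \<Rightarrow>\<^sub>0 'k)) set \<Rightarrow> bool" where
  "cone C \<longleftrightarrow> C \<subseteq> F \<times> F \<and> (\<forall>(a, b)\<in>C. \<forall>(c, d)\<in>C. (a * c, b * d) \<in> C) \<and>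
     (\<forall>(a, b)\<in>C. \<not> commensurable a b)"

lemma coneI:
  assumes "\<And>a b. (a, b) \<in> C \<Longrightarrow> a \<in> F \<and> b \<in> F"
    and "\<And>a b c d. (a, b) \<in> C \<Longrightarrow> (c, d) \<in> C \<Longrightarrow> (a * c, b * d) \<in> C"
    and "\<And>a b. (a, b) \<in> C \<Longrightarrow> \<not> commensurable a b"
  shows "cone C"
  using assms unfolding cone_def by auto

lemma cone_F: "cone C \<Longrightarrow> (a, b) \<in> C \<Longrightarrow> a \<in> F \<and> b \<in> F"
  and cone_mult: "cone C \<Longrightarrow> (a, b) \<in> C \<Longrightarrow> (c, d) \<in> C \<Longrightarrow> (a * c, b * d) \<in> C"
  and cone_not_commensurable: "cone C \<Longrightarrow> (a, b) \<in> C \<Longrightarrow> \<not> commensurable a b"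
  unfolding cone_def by blast+

lemma cone_power: "cone C \<Longrightarrow> (a, b) \<in> C \<Longrightarrow> n > 0 \<Longrightarrow> (a ^ n, b ^ n) \<in> C"
proof (induction n)
  case (Suc n)
  then show ?case using cone_mult[of C a b "a ^ n" "b ^ n"] by (cases "n = 0") auto
qed simp

text \<open>\<open>F\<close> modulo commensurability is a cancellative torsion-free monoid, so a maximal strict cone
  is a total order on it.\<close>

lemma maximal_cone_total:
  assumes C: "cone C" and max: "\<And>C'. cone C' \<Longrightarrow> C \<subseteq> C' \<Longrightarrow> C' = C"
    and f: "f \<in> F" and g: "g \<in> F" and fg: "\<not> commensurable f g" "(f, g) \<notin> C"
  shows "\<exists>a b n. (a, b) \<in> C \<and> n > 0 \<and> commensurable (a * f ^ n) (b * g ^ n)"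
proof (rule ccontr)
  assume contra: "\<not> ?thesis"
  \<comment> \<open>The pair \<open>(f, g)\<close> is adjoined with its powers;
    \<open>(1, 1)\<close>, which lies in no cone, is inserted so that bare powers occur. Strictness
    can fail only as in the claim, since a relation between \<open>f^n\<close> and
    \<open>g^n\<close> gives one between \<open>f\<close> and \<open>g\<close>.\<close>
  define C' where "C' = C \<union> {(a * f ^ n, b * g ^ n) | a b n. (a, b) \<in> insert (1, 1) C \<and> n > 0}"
  have old: "(a, b) \<in> C'" if "(a, b) \<in> C" for a b using that by (simp add: C'_def)
  have new: "(a * f ^ n, b * g ^ n) \<in> C'" if "(a, b) \<in> insert (1, 1) C" "n > 0" for a b n
    using that unfolding C'_def by blast
  have ins_mult: "(a * c, b * d) \<in> insert (1, 1) C"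
    if "(a, b) \<in> insert (1, 1) C" "(c, d) \<in> insert (1, 1) C" for a b c d
    using that cone_mult[OF C] by auto
  have C'_cases: "\<exists>c d n. (c, d) \<in> insert (1, 1) C \<and> a = c * f ^ n \<and> b = d * g ^ n \<and>
      ((c, d) \<in> C \<or> n > 0)" if "(a, b) \<in> C'" for a b
  proof (cases "(a, b) \<in> C")
    case True
    then show ?thesis by (intro exI[of _ a] exI[of _ b] exI[of _ 0]) simp
  next
    case False
    then show ?thesis using that unfolding C'_def by blast
  qed
  have C'_intro: "(c * f ^ n, d * g ^ n) \<in> C'"
    if "(c, d) \<in> insert (1, 1) C" "(c, d) \<in> C \<or> n > 0" for c d n
    using that old new by (cases "n = 0") auto
  have "cone C'"
  proof (rule coneI)
    fix a b assume "(a, b) \<in> C'"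
    then obtain c d n where cd: "(c, d) \<in> insert (1, 1) C" "a = c * f ^ n" "b = d * g ^ n"
      "(c, d) \<in> C \<or> n > 0" using C'_cases by meson
    have "c \<in> F \<and> d \<in> F" using cd(1) cone_F[OF C] F_one by blast
    then show "a \<in> F \<and> b \<in> F" using cd f g F_mult F_power by simp
    show "\<not> commensurable a b"
    proof
      assume ab: "commensurable a b"
      show False
      proof (cases "n = 0")
        case True
        then show False using cd ab cone_not_commensurable[OF C] by auto
      next
        case False
        have "(c, d) \<noteq> (1, 1)"
          using ab cd False commensurable_power[of f n g] fg(1) by auto
        then show False using cd ab False contra by blast
      qed
    qed
  next
    fix a b c d assume "(a, b) \<in> C'" "(c, d) \<in> C'"
    then obtain a1 b1 n c1 d1 k where
      1: "(a1, b1) \<in> insert (1, 1) C" "a = a1 * f ^ n" "b = b1 * g ^ n" "(a1, b1) \<in> C \<or> n > 0"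
      "(c1, d1) \<in> insert (1, 1) C" "c = c1 * f ^ k" "d = d1 * g ^ k" "(c1, d1) \<in> C \<or> k > 0"
      using C'_cases by meson
    have "(a1 * c1, b1 * d1) \<in> C \<or> n + k > 0"
      using 1 cone_mult[OF C] by auto
    then have "((a1 * c1) * f ^ (n + k), (b1 * d1) * g ^ (n + k)) \<in> C'"
      by (intro C'_intro ins_mult 1)
    then show "(a * c, b * d) \<in> C'"
      using 1 by (simp add: power_add mult_ac)
  qed
  moreover have "C \<subseteq> C'" unfolding C'_def by blast
  ultimately have "C' = C" by (rule max)
  moreover have "(1 * f ^ 1, 1 * g ^ 1) \<in> C'" by (rule new) simp_all
  ultimately show False using fg(2) by simp
qed

lemma ex_total_cone:
  obtains C where "cone C"
    "\<And>f g. f \<in> F \<Longrightarrow> g \<in> F \<Longrightarrow> \<not> commensurable f g \<Longrightarrow> (f, g) \<in> C \<or> (g, f) \<in> C"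
proof -
  have "\<exists>C\<in>Collect cone. \<forall>C'\<in>Collect cone. C \<subseteq> C' \<longrightarrow> C' = C"
  proof (rule subset_Zorn')
    fix \<K> assume \<K>: "subset.chain (Collect cone) \<K>"
    then have K: "cone K" if "K \<in> \<K>" for K
      using that unfolding subset.chain_def by blast
    have tot: "K \<subseteq> K' \<or> K' \<subseteq> K" if "K \<in> \<K>" "K' \<in> \<K>" for K K'
      using \<K> that unfolding subset_chain_def by blast
    have "cone (\<Union>\<K>)"
    proof (rule coneI)
      fix a b assume "(a, b) \<in> \<Union>\<K>"
      then show "a \<in> F \<and> b \<in> F" "\<not> commensurable a b"
        using K cone_F cone_not_commensurable by blast+
    next
      fix a b c d assume "(a, b) \<in> \<Union>\<K>" "(c, d) \<in> \<Union>\<K>"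
      then obtain K K' where "(a, b) \<in> K" "K \<in> \<K>" "(c, d) \<in> K'" "K' \<in> \<K>" by blast
      then have "\<exists>K\<in>\<K>. (a, b) \<in> K \<and> (c, d) \<in> K" using tot by blast
      then show "(a * c, b * d) \<in> \<Union>\<K>" using K cone_mult by blast
    qed
    then show "\<Union>\<K> \<in> Collect cone" by simp
  qed
  then obtain C where C: "cone C" and max: "\<And>C'. cone C' \<Longrightarrow> C \<subseteq> C' \<Longrightarrow> C' = C" by blast
  show thesis
  proof (rule that[OF C], rule ccontr)
    fix f g assume f: "f \<in> F" and g: "g \<in> F" and fg: "\<not> commensurable f g"
      and no: "\<not> ((f, g) \<in> C \<or> (g, f) \<in> C)"
    have gf: "\<not> commensurable g f" using commensurable_sym[OF g] fg by blast
    obtain a b n where 1: "(a, b) \<in> C" "n > 0" "commensurable (a * f ^ n) (b * g ^ n)"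
      using maximal_cone_total[OF C max f g fg] no by blast
    obtain c d k where 2: "(c, d) \<in> C" "k > 0" "commensurable (c * g ^ k) (d * f ^ k)"
      using maximal_cone_total[OF C max g f gf] no by blast
    have F: "a \<in> F" "b \<in> F" "c \<in> F" "d \<in> F" using 1(1) 2(1) cone_F[OF C] by auto
    have pow: "commensurable (x ^ i) (y ^ i)" if "commensurable x y" "x \<in> F" "y \<in> F" for x y i
      using that commensurable_mult F_power
      by (induction i) (simp_all add: commensurable_refl)
    \<comment> \<open>Raising the two relations to the powers \<open>k\<close> and \<open>n\<close>
      and multiplying gives both sides this common factor; cancelling it makes a pair of
      \<open>C\<close> commensurable.\<close>
    define z where "z = f ^ (n * k) * g ^ (n * k)"
    have z: "z \<in> F" unfolding z_def using f g by (intro F_mult F_power)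
    have "commensurable ((a * f ^ n) ^ k * (c * g ^ k) ^ n) ((b * g ^ n) ^ k * (d * f ^ k) ^ n)"
      using F f g
      by (intro commensurable_mult pow[OF 1(3)] pow[OF 2(3)] F_mult F_power)
    moreover have "(a * f ^ n) ^ k * (c * g ^ k) ^ n = (a ^ k * c ^ n) * z"
      by (simp add: z_def power_mult_distrib power_mult[symmetric] mult_ac)
    moreover have "(b * g ^ n) ^ k * (d * f ^ k) ^ n = (b ^ k * d ^ n) * z"
      by (simp add: z_def power_mult_distrib power_mult[symmetric] mult_ac)
    ultimately have "commensurable (a ^ k * c ^ n) (b ^ k * d ^ n)"
      using commensurable_cancel[OF z] by simp
    moreover have "(a ^ k * c ^ n, b ^ k * d ^ n) \<in> C"
      using 1 2 by (intro cone_mult[OF C] cone_power[OF C])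
    ultimately show False using cone_not_commensurable[OF C] by blast
  qed
qed

text \<open>Formally \<open>v / u\<close> is \<open>y / x\<close> with \<open>x > y\<close>, so
  \<open>u\<close> is the larger element. Lines not linked by elements of \<open>F\<close> stay
  incomparable even if \<open>C\<close> is total.\<close>

definition dominates :: "(('q \<Rightarrow>\<^sub>0 'k) \<times> ('q \<Rightarrow>\<^sub>0 'k)) set \<Rightarrow> 'm \<Rightarrow> 'm \<Rightarrow> bool" where
  "dominates C u v \<longleftrightarrow> (\<exists>x y c. (x, y) \<in> C \<and> x *s v - cst c *s y *s u \<in> N)"

lemma dominates_trans:
  assumes C: "cone C" and "dominates C u v" "dominates C v w"
  shows "dominates C u w"
proof -
  obtain x y c where 1: "(x, y) \<in> C" "x *s v - cst c *s y *s u \<in> N"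
    using assms(2) unfolding dominates_def by blast
  obtain x' y' d where 2: "(x', y') \<in> C" "x' *s w - cst d *s y' *s v \<in> N"
    using assms(3) unfolding dominates_def by blast
  have "x *s (x' *s w - cst d *s y' *s v) + (cst d * y') *s (x *s v - cst c *s y *s u)
      = (x * x') *s w - cst (d * c) *s (y * y') *s u"
    by (simp add: scale_right_diff_distrib cst_mult mult_ac)
  moreover have "x *s (x' *s w - cst d *s y' *s v) + (cst d * y') *s (x *s v - cst c *s y *s u) \<in> N"
    using 1(2) 2(2) by (intro subspace_add[OF N_subspace] subspace_scale[OF N_subspace])
  ultimately show ?thesis
    using cone_mult[OF C 1(1) 2(1)] unfolding dominates_def by metis
qed

lemma not_dominates_self:
  assumes C: "cone C" and u: "u \<in> Homog" "u \<notin> N"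
  shows "\<not> dominates C u u"
proof
  assume "dominates C u u"
  then obtain x y c where 1: "(x, y) \<in> C" "x *s u - cst c *s y *s u \<in> N"
    unfolding dominates_def by blast
  then have "(x ^ 1 - cst c * y ^ 1) *s u \<in> N" by (simp add: scale_left_diff_distrib)
  then have "commensurable x y" using u unfolding commensurable_def by blast
  then show False using cone_not_commensurable[OF C 1(1)] by blast
qed

text \<open>The product of the leading term of \<open>\<Sum> a\<^sub>x x\<close> with a leading term of an element
  cannot be cancelled.\<close>

lemma regular_incommensurable_sum:
  assumes A: "finite A" "A \<noteq> {}" "A \<subseteq> F" "\<And>x. x \<in> A \<Longrightarrow> a x \<noteq> 0"
    "\<And>x y. x \<in> A \<Longrightarrow> y \<in> A \<Longrightarrow> x \<noteq> y \<Longrightarrow> \<not> commensurable x y"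
  shows "regular (\<Sum>x\<in>A. cst (a x) * x)"
  unfolding regular_def
proof (intro allI impI, rule ccontr)
  fix m assume m: "(\<Sum>x\<in>A. cst (a x) * x) *s m \<in> N" "m \<notin> N"
  obtain C where C: "cone C"
    "\<And>f g. f \<in> F \<Longrightarrow> g \<in> F \<Longrightarrow> \<not> commensurable f g \<Longrightarrow> (f, g) \<in> C \<or> (g, f) \<in> C"
    by (rule ex_total_cone) blast
  obtain I b where I: "finite I" "I \<subseteq> Homog" "m - (\<Sum>u\<in>I. cst (b u) *s u) \<in> N"
    "\<forall>u\<in>I. b u \<noteq> 0 \<and> u \<notin> N" "\<forall>u\<in>I. \<forall>v\<in>I. u \<noteq> v \<longrightarrow> (\<forall>c. u - cst c *s v \<notin> N)"
    using reduced_Homog_representation[OF N_subspace, of m] by (elim exE conjE)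
  have "I \<noteq> {}" using I(3) m(2) by auto
  \<comment> \<open>As \<open>(y, x)\<close> in \<open>C\<close> reads \<open>y > x\<close>, a
    minimal element for this relation is the leading monomial.\<close>
  have "\<exists>x\<in>A. \<forall>y\<in>A. y \<noteq> x \<longrightarrow> (y, x) \<notin> C"
  proof (rule Finite_Set.bex_min_element[OF A(1) _ _ A(2)])
    show "asymp_on A (\<lambda>x y. (x, y) \<in> C)"
    proof (rule asymp_onI)
      fix x y assume "(x, y) \<in> C"
      then show "(y, x) \<notin> C"
        using cone_mult[OF C(1), of x y y x] cone_not_commensurable[OF C(1), of "x * y" "y * x"]
          commensurable_refl[of "x * y"] by (auto simp: mult.commute)
    qed
    \<comment> \<open>The cone yields only \<open>(x y, y z)\<close>, whose common factor cannot be
      cancelled inside \<open>C\<close>. Totality is used instead: both alternatives to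
      \<open>(x, z)\<close> contradict strictness.\<close>
    show "transp_on A (\<lambda>x y. (x, y) \<in> C)"
    proof (rule transp_onI)
      fix x y z assume "x \<in> A" "y \<in> A" "z \<in> A" and xy: "(x, y) \<in> C" and yz: "(y, z) \<in> C"
      then have F: "x \<in> F" "y \<in> F" "z \<in> F" using A(3) by auto
      note xyz = cone_mult[OF C(1) xy yz]
      have "\<not> commensurable x z"
      proof
        assume "commensurable x z"
        from commensurable_mult[OF F(1,3) F(2,2) this commensurable_refl]
        have "commensurable (x * y) (y * z)" by (simp only: mult.commute)
        then show False using cone_not_commensurable[OF C(1) xyz] by blast
      qed
      moreover have "(z, x) \<notin> C"
      proof
        assume "(z, x) \<in> C"
        from cone_not_commensurable[OF C(1) cone_mult[OF C(1) xyz this]]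
        have "\<not> commensurable (x * y * z) (y * z * x)" .
        then show False using commensurable_refl[of "x * y * z"] by (simp add: mult_ac)
      qed
      ultimately show "(x, z) \<in> C" using C(2) F by blast
    qed
  qed
  then obtain x0 where x0: "x0 \<in> A" "\<And>y. y \<in> A \<Longrightarrow> y \<noteq> x0 \<Longrightarrow> (y, x0) \<notin> C" by blast
  have reg_x0: "regular x0" using x0(1) A(3) by (auto simp: F_def)
  \<comment> \<open>Lines are only partially ordered, so an undominated one replaces the
    largest.\<close>
  have "\<exists>u\<in>I. \<forall>v\<in>I. v \<noteq> u \<longrightarrow> \<not> dominates C v u"
  proof (rule Finite_Set.bex_min_element[OF I(1) _ _ \<open>I \<noteq> {}\<close>])
    show "asymp_on I (dominates C)"
    proof (rule asymp_onI)
      fix u v assume "u \<in> I" "dominates C u v"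
      moreover have "u \<in> Homog" "u \<notin> N" using \<open>u \<in> I\<close> I(2,4) by auto
      ultimately show "\<not> dominates C v u"
        using dominates_trans[OF C(1), of u v u] not_dominates_self[OF C(1), of u] by blast
    qed
    show "transp_on I (dominates C)"
      using dominates_trans[OF C(1)] by (intro transp_onI)
  qed
  then obtain u0 where u0: "u0 \<in> I" "\<And>v. v \<in> I \<Longrightarrow> v \<noteq> u0 \<Longrightarrow> \<not> dominates C v u0" by blast
  define f where "f = (\<lambda>(x, u). cst (a x * b u) *s x *s u)"
  have "f (x0, u0) \<in> N"
  proof (rule isolated_term_in[OF N, of "A \<times> I"])
    show "finite (A \<times> I)" "(x0, u0) \<in> A \<times> I" using A I x0 u0 by auto
    show "f j \<in> Homog" if "j \<in> A \<times> I" for j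
      using that A(3) I(2) unfolding f_def F_def
      by (auto simp del: scale_scale intro!: cst_Homog monomial_Homog)
    have "(\<Sum>x\<in>A. cst (a x) * x) *s (\<Sum>u\<in>I. cst (b u) *s u)
        = (\<Sum>x\<in>A. \<Sum>u\<in>I. (cst (a x) * x) *s cst (b u) *s u)"
      by (subst scale_sum_left) (simp only: scale_sum_right)
    also have "\<dots> = (\<Sum>j\<in>A \<times> I. f j)"
      unfolding f_def sum.cartesian_product by (intro sum.cong) (auto simp: cst_mult mult_ac)
    finally have prod: "(\<Sum>x\<in>A. cst (a x) * x) *s (\<Sum>u\<in>I. cst (b u) *s u) = (\<Sum>j\<in>A \<times> I. f j)" .
    have "(\<Sum>x\<in>A. cst (a x) * x) *s m
        - (\<Sum>x\<in>A. cst (a x) * x) *s (m - (\<Sum>u\<in>I. cst (b u) *s u)) \<in> N"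
      by (intro subspace_diff[OF N_subspace m(1)] subspace_scale[OF N_subspace] I(3))
    then show "(\<Sum>j\<in>A \<times> I. f j) \<in> N"
      unfolding prod[symmetric] scale_right_diff_distrib by simp
    \<comment> \<open>For a proportional term outside \<open>N\<close>, either
      \<open>x = x0\<close>, and cancelling \<open>x0\<close> makes \<open>u\<close> and
      \<open>u0\<close> proportional against reducedness, or \<open>x\<close> is below
      \<open>x0\<close>, and then \<open>u\<close> dominates \<open>u0\<close>.\<close>
    show "f j \<in> N" if j: "j \<in> A \<times> I" "j \<noteq> (x0, u0)" and c: "f j - cst c *s f (x0, u0) \<in> N" for j c
    proof (rule ccontr)
      assume not_N: "f j \<notin> N"
      obtain x u where xu: "j = (x, u)" "x \<in> A" "u \<in> I" using j(1) by blast
      define \<alpha> \<beta> where "\<alpha> = a x * b u" and "\<beta> = c * (a x0 * b u0)"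
      have "c \<noteq> 0" using c not_N by auto
      then have "\<alpha> \<noteq> 0" "\<beta> \<noteq> 0"
        unfolding \<alpha>_def \<beta>_def using A(4) I(4) xu x0(1) u0(1) by auto
      have "cst \<alpha> *s x *s u - cst \<beta> *s x0 *s u0 \<in> N"
        using c unfolding xu(1) f_def \<alpha>_def \<beta>_def by (simp add: cst_mult mult.assoc)
      then have "cst (- inverse \<beta>) *s (cst \<alpha> *s x *s u - cst \<beta> *s x0 *s u0) \<in> N"
        by (rule subspace_scale[OF N_subspace])
      moreover have "cst (- inverse \<beta>) *s (cst \<alpha> *s x *s u - cst \<beta> *s x0 *s u0)
          = x0 *s u0 - cst (\<alpha> / \<beta>) *s x *s u"
      proof -
        have "cst (- inverse \<beta>) *s cst \<beta> *s x0 *s u0 = - (x0 *s u0)"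
          using cst_scale_cancel[OF \<open>\<beta> \<noteq> 0\<close>, of "x0 *s u0"]
          by (simp add: cst_minus scale_minus_left del: scale_scale)
        moreover have "cst (- inverse \<beta>) *s cst \<alpha> *s x *s u = - (cst (\<alpha> / \<beta>) *s x *s u)"
          by (simp add: cst_minus scale_minus_left field_class.field_divide_inverse cst_mult mult_ac)
        ultimately show ?thesis by (simp only: scale_right_diff_distrib) simp
      qed
      ultimately have rel: "x0 *s u0 - cst (\<alpha> / \<beta>) *s x *s u \<in> N" by simp
      show False
      proof (cases "x = x0")
        case True
        have "x0 *s (u0 - cst (\<alpha> / \<beta>) *s u) \<in> N"
          using rel unfolding True by (simp add: scale_right_diff_distrib mult.commute)
        then have "u0 - cst (\<alpha> / \<beta>) *s u \<in> N"
          using regularD[OF reg_x0] by blast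
        moreover have "u0 \<noteq> u" using j(2) xu(1) True by simp
        ultimately show False using I(5)[rule_format, OF u0(1) xu(3)] by simp
      next
        case False
        then have "(x0, x) \<in> C"
          using C(2)[of x0 x] A(3,5) x0 xu(2) by blast
        then have dom: "dominates C u u0" using rel unfolding dominates_def by blast
        show False
        proof (cases "u = u0")
          case True
          then show False using dom not_dominates_self[OF C(1), of u0] u0(1) I(2,4) by blast
        next
          case False
          then show False using dom u0(2) xu(3) by blast
        qed
      qed
    qed
  qed
  then have "x0 *s u0 \<in> N"
    using cst_scale_in_iff[OF N_subspace, of "a x0 * b u0"] A(4)[OF x0(1)] I(4) u0(1)
    unfolding f_def by (simp del: scale_scale)
  then have "u0 \<in> N" using regularD[OF reg_x0] by blast
  then show False using I(4) u0(1) by blast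
qed

text \<open>\<open>reduced_representation\<close> is applied to the algebra itself modulo its
  subspace of nilpotent elements. The surviving monomials are not nilpotent, hence regular, and
  commensurable ones would have been merged.\<close>

lemma monomial_sum_plus_nilpotent:
  "\<exists>A a. finite A \<and> A \<subseteq> F \<and> nilpotent (r - (\<Sum>x\<in>A. cst (a x) * x)) \<and> (\<forall>x\<in>A. a x \<noteq> 0) \<and>
     (\<forall>x\<in>A. \<forall>y\<in>A. x \<noteq> y \<longrightarrow> \<not> commensurable x y)"
proof -
  have "module ((*) :: ('q \<Rightarrow>\<^sub>0 'k) \<Rightarrow> _)"
    by unfold_locales (simp_all add: algebra_simps)
  then interpret ring: vector_space "const_scale ((*) :: ('q \<Rightarrow>\<^sub>0 'k) \<Rightarrow> _)"
    by (rule vector_space_const_scale)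
  have scale: "const_scale (*) c s = cst c * s" for c and s :: "'q \<Rightarrow>\<^sub>0 'k"
    by (simp add: const_scale_def cst_def)
  have "s \<in> ring.span monomials" for s :: "'q \<Rightarrow>\<^sub>0 'k"
  proof -
    have "(\<Sum>q\<in>Poly_Mapping.keys s.
        const_scale (*) (Poly_Mapping.lookup s q) (monoid_monomial q)) \<in> ring.span monomials"
      by (intro ring.span_sum ring.span_scale ring.span_base) simp
    then show ?thesis unfolding scale poly_mapping_expand[of s, symmetric] .
  qed
  then have span: "ring.span monomials = UNIV" by blast
  have "ring.subspace (Collect nilpotent)"
    by (rule ring.subspaceI) (simp_all add: nilpotent_0 nilpotent_add nilpotent_mult scale)
  from ring.reduced_representation[OF span this, of r]
  obtain A a where A: "finite A" "A \<subseteq> monomials" "r - (\<Sum>x\<in>A. cst (a x) * x) \<in> Collect nilpotent"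
    "\<forall>x\<in>A. a x \<noteq> 0 \<and> x \<notin> Collect nilpotent"
    "\<forall>x\<in>A. \<forall>y\<in>A. x \<noteq> y \<longrightarrow> (\<forall>c. x - cst c * y \<notin> Collect nilpotent)"
    unfolding scale by (elim exE conjE)
  have "A \<subseteq> F"
    using A(2,4) monomial_regular_or_nilpotent unfolding F_def by blast
  moreover have "\<not> commensurable x y" if "x \<in> A" "y \<in> A" "x \<noteq> y" for x y
    using that A(5) \<open>A \<subseteq> F\<close> commensurable_nilpotent[of x y] by blast
  ultimately show ?thesis
    using A by (intro exI[of _ A] exI[of _ a]) simp
qed

theorem primary: "primary_submodule scale N"
  unfolding primary_submodule_def
proof (intro conjI allI impI N_subspace N_proper)
  fix r m assume rm: "r *s m \<in> N \<and> m \<notin> N"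
  obtain A a where A: "finite A" "A \<subseteq> F" "nilpotent (r - (\<Sum>x\<in>A. cst (a x) * x))"
    "\<forall>x\<in>A. a x \<noteq> 0" "\<forall>x\<in>A. \<forall>y\<in>A. x \<noteq> y \<longrightarrow> \<not> commensurable x y"
    using monomial_sum_plus_nilpotent[of r] by (elim exE conjE)
  define s where "s = (\<Sum>x\<in>A. cst (a x) * x)"
  have "nilpotent r"
  proof (cases "A = {}")
    case True
    then show ?thesis using A(3) by simp
  next
    case False
    then have s: "regular s"
      unfolding s_def using A by (intro regular_incommensurable_sum) auto
    obtain n where n: "\<And>m. (r - s) ^ n *s m \<in> N"
      using A(3) unfolding s_def nilpotent_def by blast
    \<comment> \<open>As \<open>r\<close> divides \<open>s^n - (s - r)^n\<close> and
      \<open>s - r\<close> is nilpotent on \<open>M / N\<close>, \<open>r m\<close> in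
      \<open>N\<close> forces \<open>s^n m\<close> into \<open>N\<close>.\<close>
    have dvd: "s ^ n - (s - r) ^ n = (\<Sum>i<n. (s - r) ^ (n - Suc i) * s ^ i) * r"
      using power_diff_sumr2[of s n "s - r"] by (simp add: mult.commute)
    then have "(s ^ n - (s - r) ^ n) *s m \<in> N"
      using subspace_scale[OF N_subspace, of "r *s m"] rm by simp
    have "(s - r) ^ n = (- 1) ^ n * (r - s) ^ n"
      by (metis minus_diff_eq power_minus)
    then have "(s - r) ^ n *s m \<in> N"
      using subspace_scale[OF N_subspace n, of "(- 1) ^ n" m] by simp
    from subspace_add[OF N_subspace \<open>(s ^ n - (s - r) ^ n) *s m \<in> N\<close> this]
    have "s ^ n *s m \<in> N" by (simp add: scale_left_diff_distrib)
    then have "m \<in> N" by (rule regularD[OF regular_power[OF s]])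
    then show ?thesis using rm by blast
  qed
  then show "\<exists>n. \<forall>m'. r ^ n *s m' \<in> N" unfolding nilpotent_def .
qed

end

theorem corollary8p3:
  fixes scale :: "('q::comm_monoid_add \<Rightarrow>\<^sub>0 'k::alg_closed_field) \<Rightarrow> 'm::ab_group_add \<Rightarrow> 'm"
    and act :: "'q \<Rightarrow> 't \<Rightarrow> 't"
    and T :: "'t set"
    and D :: "'t \<Rightarrow> 'm set"
    and N :: "'m set"
  assumes "fg_monoid (UNIV :: 'q set)"
    and "fg_module scale"
    and "q_module act T"
    and "tightly_graded_by scale act T D"
    and "binomial_submodule scale T D N"
  shows "\<exists>C. primary_decomposition scale N C \<and> (\<forall>P\<in>C. binomial_submodule scale T D P)"
proof (rule ccontr)
  assume contra: "\<not> ?thesis"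
  interpret module scale using assms(2) unfolding fg_module_def by blast
  interpret finely_graded_module scale act T D
    by unfold_locales (use assms in \<open>auto simp: tightly_graded_by_def\<close>)
  obtain B where B: "finite B" "span B = UNIV"
    using assms(2) unfolding fg_module_def by blast
  define bad where "bad N \<longleftrightarrow> binsub N \<and>
    \<not> (\<exists>C. primary_decomposition scale N C \<and> (\<forall>P\<in>C. binsub P))" for N
  have "bad N" using contra assms(5) unfolding bad_def binomial_submodule_iff by blast
  then have "\<exists>U\<in>Collect bad. \<forall>V\<in>Collect bad. U \<subseteq> V \<longrightarrow> V = U"
    by (intro ex_maximal_submodule[OF assms(1) B]) (auto simp: bad_def binsub_subspace)
  then obtain U where U: "bad U" and max: "\<And>V. bad V \<Longrightarrow> U \<subseteq> V \<Longrightarrow> V = U" by blast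
  have "binomially_irreducible scale act T D U"
  proof unfold_locales
    show "binsub U" using U unfolding bad_def by blast
    show "U \<noteq> UNIV"
    proof
      assume "U = UNIV"
      \<comment> \<open>Primary components must be proper, so the whole module is decomposed by the
        empty family.\<close>
      then have "primary_decomposition scale U {}" by (simp add: primary_decomposition_def)
      then show False using U unfolding bad_def by blast
    qed
    show "\<exists>d. \<forall>n\<ge>d. V n = V d" if "\<And>n. subspace (V n)" "incseq V" for V :: "nat \<Rightarrow> 'm set"
      by (rule submodule_chain_stabilizes[OF assms(1) B that])
    fix \<C> assume \<C>: "finite \<C>" "\<And>P. P \<in> \<C> \<Longrightarrow> binsub P \<and> U \<subseteq> P" "\<Inter>\<C> \<subseteq> U"
    show "\<exists>P\<in>\<C>. P \<subseteq> U"
    proof (rule ccontr)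
      assume not_sub: "\<not> ?thesis"
      \<comment> \<open>Each member strictly contains \<open>U\<close>, so maximality of the
        counterexample gives it a decomposition; the union of these would decompose
        \<open>U\<close>.\<close>
      have "\<exists>C. primary_decomposition scale P C \<and> (\<forall>P'\<in>C. binsub P')" if P: "P \<in> \<C>" for P
      proof -
        have "\<not> bad P" using max[of P] \<C>(2)[OF P] not_sub P by blast
        then show ?thesis using \<C>(2)[OF P] by (simp add: bad_def)
      qed
      then have "\<forall>P\<in>\<C>. \<exists>C. primary_decomposition scale P C \<and> (\<forall>P'\<in>C. binsub P')" ..
      from bchoice[OF this] obtain G
        where G: "\<And>P. P \<in> \<C> \<Longrightarrow> primary_decomposition scale P (G P) \<and> (\<forall>P'\<in>G P. binsub P')"
        by blast
      have dec: "finite (G P)" "\<forall>P'\<in>G P. primary_submodule scale P'" "\<Inter>(G P) = P" if "P \<in> \<C>" for P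
        using G[OF that] by (simp_all add: primary_decomposition_def)
      have "\<Inter>(\<Union>P\<in>\<C>. G P) = (\<Inter>P\<in>\<C>. \<Inter>(G P))" by blast
      also have "\<dots> = (\<Inter>P\<in>\<C>. P)" by (rule INF_cong[OF refl dec(3)])
      also have "\<dots> = U" using \<C>(2,3) by auto
      finally have "primary_decomposition scale U (\<Union>P\<in>\<C>. G P)"
        using dec(1,2) \<C>(1) by (auto simp: primary_decomposition_def)
      moreover have "\<forall>P'\<in>(\<Union>P\<in>\<C>. G P). binsub P'" using G by blast
      ultimately show False using U unfolding bad_def by blast
    qed
  qed
  then have "primary_submodule scale U" by (rule binomially_irreducible.primary)
  then have "primary_decomposition scale U {U}" by (simp add: primary_decomposition_def)
  then show False using U unfolding bad_def by blast
qed

end
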